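(* Let $n\geq 2$, let $\Omega\subset\mathbb{C}$ be an $n$-connected domain with non-degenerate boundary components $\{\Gamma_i\}_{i\in\{1,2,\dots,n\}}$, and let $z\in\Omega$. For $i,j\in\{1,\dots,n\}$ with $i\neq j$, let $r_{\Omega,i,j}(z)$ be the distance from $0$ to the circular slit corresponding to $\Gamma_i$ under the conformal map $\psi_{z,j}$ of $\Omega$ onto a circularly slit disc with $\psi_{z,j}(z)=0$, $\psi_{z,j}'(z)>0$ and $\psi_{z,j}(\Gamma_j)=\partial\Delta$. Then the squeezing function $S_\Omega$ of $\Omega$ satisfies $$\max_{j\in\{1,\dots,n\}}\ \min_{\substack{i\in\{1,\dots,n\}\\ i\neq j}} r_{\Omega,i,j}(z)\ \leq\ S_{\Omega}(z)\ \leq\ \max_{j\in\{1,\dots,n\}}\ \max_{\substack{i\in\{1,\dots,n\}\\ i\neq j}} r_{\Omega,i,j}(z).$$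
   Context: Let $\mathbb{P}^1$ be the Riemann sphere and $\Delta=\{w\in\mathbb{C}:|w|<1\}$ the open unit disc. For a set $A\subset\mathbb{C}$, $d(0,A)$ denotes the Euclidean distance from $0$ to $A$. A domain is a connected non-empty open set. A domain $\Omega\subset\mathbb{C}$ is $n$-connected if $\mathbb{P}^1\setminus\Omega$ has exactly $n$ connected components. It has non-degenerate boundary if no component of $\mathbb{P}^1\setminus\Omega$ is a single point. In that case $\Gamma_1,\dots,\Gamma_n$ denote its boundary components (the connected components of the boundary of $\Omega$ in $\mathbb{P}^1$, one for each component of $\mathbb{P}^1\setminus\Omega$). Squeezing function: let $\mathcal{U}(\Omega)$ be the set of injective holomorphic maps $f:\Omega\to\Delta$. For $z\in\Omega$, $$S_\Omega(z):=\sup_{\substack{f\in\mathcal{U}(\Omega)\\ f(z)=0}}\{r\in(0,1]: r\Delta\subset f(\Omega)\}=\sup_{\substack{f\in\mathcal{U}(\Omega)\\ f(z)=0}} d(0,\partial f(\Omega)).$$ Circularly slit disc: a domain $C\subset\Delta$ such that the connected components of $\Delta\setminus C$ are closed proper arcs of circles centered at the origin. Boundary correspondence: if $f:\Omega_1\to\Omega_2$ is a biholomorphism and $\Gamma\subset\partial\Omega_1$, $\Gamma'\subset\partial\Omega_2$, then $f(\Gamma)=\Gamma'$ means that, for every sequence $\{z_k\}\subset\Omega_1$, $z_k$ tends to $\Gamma$ if and only if $f(z_k)$ tends to $\Gamma'$. Known fact defining the notation: for $\Omega$ an $n$-connected domain with non-degenerate boundary components $\Gamma_1,\dots,\Gamma_n$,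 $z\in\Omega$ and $j\in\{1,\dots,n\}$, there is a unique biholomorphism $\psi_{z,j}$ of $\Omega$ onto a circularly slit disc, denoted $C_{z,j}(\Omega)$, such that $\psi_{z,j}(z)=0$, $\psi_{z,j}'(z)>0$ and $\psi_{z,j}(\Gamma_j)=\partial\Delta$ in the sense of boundary correspondence. For $i\neq j$, let $s_{\Omega,i,j}=\psi_{z,j}(\Gamma_i)$ (in the sense of boundary correspondence) be the component of $\Delta\setminus C_{z,j}(\Omega)$ corresponding to $\Gamma_i$, which is a closed arc of a circle centered at $0$, and set $r_{\Omega,i,j}(z)=d(0,s_{\Omega,i,j})$, i.e. the radius of that circle. *)

theory Defs
  imports "HOL-Complex_Analysis.Complex_Analysis"
begin

text \<open>The Riemann sphere as the one-point compactification of the complex plane: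
  \<^term>\<open>None\<close> is the point at infinity, and \<^term>\<open>Some\<close> embeds the plane.\<close>

definition riemann_sphere :: "complex option topology" where
  "riemann_sphere = Alexandroff_compactification (euclidean :: complex topology)"

definition sphere_components :: "complex option set \<Rightarrow> complex option set set" where
  "sphere_components A = connected_components_of (subtopology riemann_sphere A)"

definition complement_components :: "complex set \<Rightarrow> complex option set set" where
  "complement_components \<Omega> = sphere_components (topspace riemann_sphere - Some ` \<Omega>)"

definition boundary_components :: "complex set \<Rightarrow> complex option set set" where
  "boundary_components \<Omega> = sphere_components (riemann_sphere frontier_of (Some ` \<Omega>))"

definition plane_domain :: "complex set \<Rightarrow> bool" where
  "plane_domain \<Omega> \<longleftrightarrow> open \<Omega> \<and> connected \<Omega> \<and> \<Omega> \<noteq> {}"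

definition n_connected :: "nat \<Rightarrow> complex set \<Rightarrow> bool" where
  "n_connected n \<Omega> \<longleftrightarrow> plane_domain \<Omega> \<and>
     finite (complement_components \<Omega>) \<and> card (complement_components \<Omega>) = n"

definition nondegenerate_boundary :: "complex set \<Rightarrow> bool" where
  "nondegenerate_boundary \<Omega> \<longleftrightarrow> (\<forall>K\<in>complement_components \<Omega>. \<nexists>p. K = {p})"

definition univalent_maps :: "complex set \<Rightarrow> (complex \<Rightarrow> complex) set" where
  "univalent_maps \<Omega> = {f. f holomorphic_on \<Omega> \<and> inj_on f \<Omega> \<and> f ` \<Omega> \<subseteq> ball 0 1}"

definition squeezing :: "complex set \<Rightarrow> complex \<Rightarrow> real" where
  "squeezing \<Omega> z =
     Sup {r. 0 < r \<and> r \<le> 1 \<and> (\<exists>f\<in>univalent_maps \<Omega>. f z = 0 \<and> ball 0 r \<subseteq> f ` \<Omega>)}"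

text \<open>A sequence tends to a subset of the sphere if it eventually enters every neighbourhood of
  it; for a compact subset this says that its spherical distance to the subset tends to 0.\<close>

definition tends_to_set :: "(nat \<Rightarrow> complex) \<Rightarrow> complex option set \<Rightarrow> bool" where
  "tends_to_set s \<Gamma> \<longleftrightarrow>
     (\<forall>U. openin riemann_sphere U \<and> \<Gamma> \<subseteq> U \<longrightarrow> (\<forall>\<^sub>F k in sequentially. Some (s k) \<in> U))"

definition boundary_corresponds ::
  "(complex \<Rightarrow> complex) \<Rightarrow> complex set \<Rightarrow> complex option set \<Rightarrow> complex option set \<Rightarrow> bool" where
  "boundary_corresponds f \<Omega> \<Gamma> \<Gamma>' \<longleftrightarrow>
     (\<forall>s. range s \<subseteq> \<Omega> \<longrightarrow> (tends_to_set s \<Gamma> \<longleftrightarrow> tends_to_set (f \<circ> s) \<Gamma>'))"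

definition biholomorphism :: "(complex \<Rightarrow> complex) \<Rightarrow> complex set \<Rightarrow> complex set \<Rightarrow> bool" where
  "biholomorphism f A B \<longleftrightarrow>
     f holomorphic_on A \<and> bij_betw f A B \<and> inv_into A f holomorphic_on B"

definition closed_proper_arc :: "complex set \<Rightarrow> bool" where
  "closed_proper_arc s \<longleftrightarrow>
     (\<exists>r a b. 0 < r \<and> a < b \<and> b < a + 2 * pi \<and> s = path_image (part_circlepath 0 r a b))"

definition circularly_slit_disc :: "complex set \<Rightarrow> bool" where
  "circularly_slit_disc C \<longleftrightarrow> plane_domain C \<and> C \<subseteq> ball 0 1 \<and>
     (\<forall>s\<in>components (ball 0 1 - C). closed_proper_arc s)"

text \<open>The defining properties of the normalised slit map sending the boundary component
  \<open>\<Gamma>\<close> to the unit circle.  They determine \<open>\<psi>\<close> only on \<open>\<Omega>\<close>.\<close>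

definition slit_map ::
  "complex set \<Rightarrow> complex \<Rightarrow> complex option set \<Rightarrow> (complex \<Rightarrow> complex) \<Rightarrow> bool" where
  "slit_map \<Omega> z \<Gamma> \<psi> \<longleftrightarrow>
     circularly_slit_disc (\<psi> ` \<Omega>) \<and> biholomorphism \<psi> \<Omega> (\<psi> ` \<Omega>) \<and>
     \<psi> z = 0 \<and> deriv \<psi> z \<in> \<real> \<and> 0 < Re (deriv \<psi> z) \<and>
     boundary_corresponds \<psi> \<Omega> \<Gamma> (Some ` sphere 0 1)"

definition slit :: "complex set \<Rightarrow> (complex \<Rightarrow> complex) \<Rightarrow> complex option set \<Rightarrow> complex set" where
  "slit \<Omega> \<psi> \<Gamma> = (THE s. s \<in> components (ball 0 1 - \<psi> ` \<Omega>) \<and>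
     boundary_corresponds \<psi> \<Omega> \<Gamma> (Some ` s))"

definition slit_radius :: "complex set \<Rightarrow> (complex \<Rightarrow> complex) \<Rightarrow> complex option set \<Rightarrow> real" where
  "slit_radius \<Omega> \<psi> \<Gamma> = infdist 0 (slit \<Omega> \<psi> \<Gamma>)"

end

theory Submission
  imports Defs
begin

text \<open>
  The lower bound holds because each \<open>\<psi>\<^sub>j\<close> competes in the supremum and its image contains the disc
  up to the nearest slit.

  For the upper bound, let \<open>f\<close> be univalent with \<open>f z = 0\<close> and \<open>r\<Delta> \<subseteq> f(\<Omega>) \<subseteq> \<Delta>\<close>, choose \<open>j\<close> such that \<open>\<Gamma>\<^sub>j\<close>
  corresponds to the outer boundary of \<open>f(\<Omega>)\<close>, and put \<open>F = f \<circ> \<psi>\<^sub>j\<^sup>-\<^sup>1\<close> on the slit disc \<open>C\<close>.  Neither a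
  slit nor the complementary component of \<open>f(\<Omega>)\<close> facing it surrounds 0, so \<open>q(\<zeta>) = F(\<zeta>)/\<zeta>\<close> has a
  logarithm near each slit; away from the slits \<open>q\<close> therefore agrees with a non-vanishing continuous
  function on the whole disc, and so equals \<open>exp H\<close> there.  If all slit radii were less than \<open>r\<close>, then
  for a suitable \<open>k < 1\<close> we would have \<open>\<bar>q\<bar> > 1/k\<close> near the slits, while \<open>\<bar>q\<bar> < 1/k\<close> near the unit
  circle; the level set \<open>\<bar>q\<bar> = 1/k\<close> would be compact and non-empty, and at a maximum of \<open>Im H\<close> on it
  \<open>q\<close> could not be open.

  The correspondence of complementary components under a homeomorphism of plane domains rests on
  unicoherence of the plane: a complementary component \<open>K\<close> has arbitrarily small open neighbourhoods
  \<open>W\<close> with \<open>W - K\<close> connected.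
\<close>

subsection \<open>Complementary components and homeomorphisms\<close>

text \<open>\<open>h x\<close> tends to \<open>L\<close> as \<open>x\<close> tends to the component \<open>K\<close> of \<open>A\<close> from outside \<open>A\<close>.\<close>

definition ends_to :: "(complex \<Rightarrow> complex) \<Rightarrow> complex set \<Rightarrow> complex set \<Rightarrow> complex set \<Rightarrow> bool" where
  "ends_to h A K L \<longleftrightarrow> (\<forall>U. open U \<and> L \<subseteq> U \<longrightarrow> (\<exists>V. open V \<and> K \<subseteq> V \<and> h ` (V - A) \<subseteq> U))"

lemma ends_toE:
  assumes "ends_to h A K L" "open U" "L \<subseteq> U"
  obtains V where "open V" "K \<subseteq> V" "h ` (V - A) \<subseteq> U"
  using assms(1)[unfolded ends_to_def, rule_format, of U] assms(2,3) that by auto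

section \<open>Components of compact sets and their neighbourhoods\<close>

lemma disjoint_components:
  assumes "K \<in> components A" "L \<in> components A" "K \<noteq> L"
  shows "K \<inter> L = {}"
  using assms components_nonoverlap by blast

lemma compact_component:
  fixes A :: "'a::t2_space set"
  assumes "compact A" "K \<in> components A" shows "compact K"
  using assms closed_components compact_imp_closed in_components_subset
  by (metis closed_Int_compact inf.absorb_iff1)

lemma separate_components:
  fixes A :: "'a::euclidean_space set"
  assumes "compact A" "K \<in> components A" "L \<in> components A" "K \<noteq> L"
  obtains U V where "open U" "open V" "K \<subseteq> U" "L \<subseteq> V" "U \<inter> V = {}"
proof -
  have "compact K" "closed L" "K \<inter> L = {}"
    using assms compact_component disjoint_components compact_imp_closed by blast+
  then show ?thesis using that separation_normal_compact by metis
qed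

lemma separate_point_compact:
  fixes A :: "'a::euclidean_space set"
  assumes "compact A" "b \<notin> A"
  obtains U V where "open U" "open V" "b \<in> U" "A \<subseteq> V" "U \<inter> V = {}"
proof -
  have "compact {b}" "closed A" "{b} \<inter> A = {}" using assms compact_imp_closed by auto
  then show ?thesis using that separation_normal_compact[of "{b}" A] by (metis insert_subset)
qed

lemma finite_components_open_nbhd:
  fixes A :: "'a::euclidean_space set"
  assumes "compact A" "finite (components A)" "K \<in> components A"
  obtains G where "open G" "K \<subseteq> G" "G \<inter> A = K"
proof
  let ?R = "\<Union>(components A - {K})"
  have "closed ?R"
    using assms by (intro closed_Union) (auto intro: closed_components compact_imp_closed)
  then show "open (- ?R)" by blast
  show "K \<subseteq> - ?R" using disjoint_components[OF assms(3)] by blast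
  show "- ?R \<inter> A = K"
    using disjoint_components[OF assms(3)] in_components_subset[OF assms(3)] Union_components[of A] by blast
qed

text \<open>\<open>W\<close> is the component of \<open>V \<inter> G\<close> around
  \<open>K\<close>. The open connected sets \<open>W\<close> and \<open>- K\<close> cover the space,
  so unicoherence makes \<open>W \<inter> - K\<close> connected; the isolating set \<open>G\<close>
  identifies it with \<open>W - A\<close>.\<close>

lemma connected_end_nbhd:
  fixes A :: "'a::euclidean_space set"
  assumes A: "compact A" "connected (- A)" and K: "K \<in> components A"
    and G: "open G" "G \<inter> A = K" and V: "open V" "K \<subseteq> V"
  obtains W where "open W" "K \<subseteq> W" "W \<subseteq> V" "connected (W - A)" "W - A \<noteq> {}"
proof -
  have Kc: "connected K" "K \<noteq> {}" "closed K" "bounded K"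
    using in_components_connected[OF K] in_components_nonempty[OF K] compact_component[OF A(1) K]
      compact_imp_closed compact_imp_bounded by auto
  have sub: "K \<subseteq> V \<inter> G" using V G by blast
  obtain x where x: "x \<in> K" using Kc by blast
  define W where "W = connected_component_set (V \<inter> G) x"
  have W: "open W" "connected W" "W \<subseteq> V \<inter> G"
    using open_connected_component[of "V \<inter> G"] V(1) G(1) connected_component_subset
    by (auto simp: W_def open_Int connected_connected_component simp del: connected_component_of_set)
  have KW: "K \<subseteq> W"
    unfolding W_def using Kc(1) sub x by (rule connected_component_maximal[rotated])
  have "connected (- K)"
    using component_complement_connected[of "- A" K] A K by simp
  then have "connected (W \<inter> - K)"
    using open_unicoherent_UNIV[of W "-K"] W Kc KW by auto
  moreover have "W - A = W \<inter> - K" using W G KW by blast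
  moreover have "W - A \<noteq> {}"
  proof
    assume "W - A = {}"
    then have "W = K" using KW W G by blast
    then have "K = UNIV" using clopen[of K] Kc W by blast
    then show False using Kc not_bounded_UNIV by metis
  qed
  ultimately show ?thesis using that[of W] W KW by auto
qed

text \<open>It supplies a point of \<open>K\<close> that can be approached from outside
  \<open>A\<close>: a non-empty compact set has a frontier point, and frontiers of components lie in
  the frontier of \<open>A\<close>.\<close>

lemma component_frontier_point:
  fixes A :: "'a::euclidean_space set"
  assumes "compact A" "K \<in> components A"
  obtains a where "a \<in> K" "a \<in> closure (- A)"
proof -
  have "bounded K" "closed K" "K \<noteq> {}"
    using in_components_nonempty[OF assms(2)] compact_component[OF assms]
      compact_imp_closed compact_imp_bounded by auto
  then obtain a where "a \<in> frontier K" using frontier_not_empty[of K] not_bounded_UNIV by blast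
  then show ?thesis using that[of a] frontier_of_components_subset[OF assms(2)] \<open>closed K\<close> frontier_closures frontier_subset_closed by fastforce
qed

lemma closure_Compl_meets:
  assumes "a \<in> closure (- A)" "open U" "a \<in> U"
  obtains x where "x \<in> U" "x \<notin> A"
proof -
  have "U \<inter> - A \<noteq> {}" using assms open_Int_closure_eq_empty[of U "- A"] by blast
  then show ?thesis using that by blast
qed

text \<open>Along a sequence tending to a point of \<open>K\<close>, the images have a cluster point
  \<open>b\<close> in \<open>B\<close>, and \<open>L\<close> is the component of \<open>b\<close>.
  The images of the connected sets \<open>W - A\<close> cannot spread over two separated pieces of
  \<open>B\<close>, so all of them follow \<open>b\<close>.\<close>

lemma ends_to_component:
  assumes A: "compact A" "connected (- A)" and K: "K \<in> components A"
    and G: "open G" "G \<inter> A = K"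
    and B: "compact B" and h: "continuous_on (- A) h" "h ` (- A) \<subseteq> - B"
    and P: "ends_to h A A B"
  obtains L where "L \<in> components B" "ends_to h A K L"
proof -
  obtain a where a: "a \<in> K" "a \<in> closure (- A)" using component_frontier_point A K by blast
  then obtain w where w: "\<And>n. w n \<in> - A" "w \<longlonglongrightarrow> a" using closure_sequential by blast
  have ev: "eventually (\<lambda>n. w n \<in> V) sequentially" if "open V" "K \<subseteq> V" for V
    using topological_tendstoD[OF w(2) that(1)] a that by blast
  \<comment> \<open>Images of points close to \<open>A\<close> stay in a ball around
    \<open>B\<close>, so some subsequence of images converges.\<close>
  obtain R where R: "B \<subseteq> ball 0 R" using B bounded_subset_ballD compact_imp_bounded by blast
  obtain V0 where V0: "open V0" "A \<subseteq> V0" "h ` (V0 - A) \<subseteq> ball 0 R"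
    using ends_toE[OF P open_ball R] by blast
  have KA: "K \<subseteq> A" using K in_components_subset by blast
  obtain N where N: "\<And>n. n \<ge> N \<Longrightarrow> w n \<in> V0"
    using ev[OF V0(1)] V0(2) KA unfolding eventually_sequentially by blast
  have "\<forall>n. h (w (n + N)) \<in> cball 0 R"
  proof
    fix n
    have "w (n+N) \<in> V0 - A" using N[of "n+N"] w(1)[of "n+N"] by auto
    then show "h (w (n+N)) \<in> cball 0 R" using V0(3) ball_subset_cball[of 0 R] by blast
  qed
  then obtain b r where r: "strict_mono r" "((\<lambda>n. h (w (n + N))) \<circ> r) \<longlonglongrightarrow> b"
    using seq_compactE[of "cball (0::complex) R" "\<lambda>n. h (w (n+N))"] compact_imp_seq_compact[OF compact_cball]
    by (metis (no_types, lifting))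
  define u where "u n = w (r n + N)" for n
  have u: "(\<lambda>n. h (u n)) \<longlonglongrightarrow> b" "\<And>n. u n \<notin> A" using r w by (auto simp: u_def o_def)
  have "u \<longlonglongrightarrow> a"
  proof -
    have "filterlim (\<lambda>n. r n + N) sequentially sequentially"
      using filterlim_add_const_nat_at_top filterlim_subseq[OF r(1)] filterlim_compose by blast
    from filterlim_compose[OF w(2) this] show ?thesis by (simp add: u_def[abs_def])
  qed
  then have evu: "eventually (\<lambda>n. u n \<in> V) sequentially" if "open V" "K \<subseteq> V" for V
    using topological_tendstoD that a by blast
  have bB: "b \<in> B"
  proof (rule ccontr)
    assume "b \<notin> B"
    then obtain U1 U2 where U: "open U1" "open U2" "b \<in> U1" "B \<subseteq> U2" "U1 \<inter> U2 = {}"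
      using separate_point_compact B by metis
    obtain V where V: "open V" "A \<subseteq> V" "h ` (V - A) \<subseteq> U2"
      using ends_toE[OF P U(2,4)] by blast
    have "eventually (\<lambda>n. u n \<in> V \<and> h (u n) \<in> U1) sequentially"
      using evu[OF V(1)] V(2) KA topological_tendstoD[OF u(1) U(1,3)] by (simp add: eventually_conj_iff)
    then obtain n where "u n \<in> V" "h (u n) \<in> U1" using eventually_happens by fastforce
    then show False using V u U by blast
  qed
  define L where "L = connected_component_set B b"
  have L: "L \<in> components B" "b \<in> L" using bB by (auto simp: L_def componentsI)
  have Lc: "compact L" using compact_component[OF B L(1)] .
  have "ends_to h A K L"
    unfolding ends_to_def
  proof (intro allI impI, elim conjE)
    fix U assume U: "open U" "L \<subseteq> U"
    \<comment> \<open>\<open>B\<close> may have infinitely many components, so \<open>L\<close> need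
      not be open in \<open>B\<close>. Sura-Bura gives a relatively clopen compact set between
      \<open>L\<close> and \<open>U\<close>, and then \<open>B1\<close> and \<open>B - B1\<close>
      are disjoint compact sets.\<close>
    obtain B1 where B1: "openin (top_of_set B) B1" "compact B1" "L \<subseteq> B1" "B1 \<subseteq> U"
      using Sura_Bura_clopen_subset[OF _ L(1) Lc U] B compact_imp_closed closed_imp_locally_compact by metis
    have "compact (B - B1)"
    proof -
      have "closedin (top_of_set B) (B - B1)" using B1(1) by (simp add: closedin_diff)
      then show ?thesis using B closedin_compact by blast
    qed
    then obtain U1 U2 where U12: "open U1" "open U2" "B1 \<subseteq> U1" "B - B1 \<subseteq> U2" "U1 \<inter> U2 = {}"
      using separation_normal_compact[of B1 "B - B1"] B1(2) compact_imp_closed by (metis Diff_disjoint)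
    have B1B: "B1 \<subseteq> B" using B1(1) openin_imp_subset by blast
    have "open ((U1 \<inter> U) \<union> U2)" "B \<subseteq> (U1 \<inter> U) \<union> U2" using U U12 B1 by auto
    then obtain V where V: "open V" "A \<subseteq> V" "h ` (V - A) \<subseteq> (U1 \<inter> U) \<union> U2"
      by (rule ends_toE[OF P])
    obtain W where W: "open W" "K \<subseteq> W" "W \<subseteq> V" "connected (W - A)" "W - A \<noteq> {}"
      using connected_end_nbhd[OF A K G V(1) subset_trans[OF KA V(2)]] by metis
    have "b \<in> U1" using L B1 U12 by blast
    then have "eventually (\<lambda>n. u n \<in> W \<and> h (u n) \<in> U1) sequentially"
      using evu[OF W(1,2)] topological_tendstoD[OF u(1) U12(1)] by (auto intro: eventually_conj)
    then obtain n where n: "u n \<in> W" "h (u n) \<in> U1" using eventually_happens by fastforce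
    have con: "connected (h ` (W - A))"
      using W(4) by (intro connected_continuous_image continuous_on_subset[OF h(1)]) auto
    have sub: "h ` (W - A) \<subseteq> (U1 \<inter> U) \<union> U2" using V W by blast
    have "h ` (W - A) \<subseteq> U1 \<inter> U"
    proof (rule ccontr)
      assume "\<not> ?thesis"
      then have "U2 \<inter> h ` (W - A) \<noteq> {}" using sub by blast
      moreover have "(U1 \<inter> U) \<inter> h ` (W - A) \<noteq> {}" using n u sub U12 by blast
      ultimately show False using connectedD[OF con, of "U1 \<inter> U" U2] U12 U sub by blast
    qed
    then show "\<exists>V. open V \<and> K \<subseteq> V \<and> h ` (V - A) \<subseteq> U" using W by blast
  qed
  then show ?thesis using that L by blast
qed

text \<open>If no component went to \<open>L\<close>, then \<open>A\<close> would be covered by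
  finitely many open sets whose images lie in sets with closures avoiding a frontier point
  \<open>b\<close> of \<open>L\<close>. But \<open>g\<close> takes points near \<open>b\<close> into
  that cover, and \<open>h\<close> takes them back.\<close>

lemma ends_to_component_onto:
  assumes A: "compact A" "connected (- A)" "finite (components A)"
    and B: "compact B" and h: "continuous_on (- A) h" "h ` (- A) \<subseteq> - B" "ends_to h A A B"
    and g: "g ` (- B) \<subseteq> - A" "\<And>y. y \<notin> B \<Longrightarrow> h (g y) = y" "ends_to g B B A"
    and L: "L \<in> components B"
  obtains K where "K \<in> components A" "ends_to h A K L"
proof (rule ccontr)
  assume neg: "\<not> thesis"
  note witness = that
  obtain b where b: "b \<in> L" "b \<in> closure (- B)" using component_frontier_point B L by blast
  have "\<exists>U V. open U \<and> open V \<and> K \<subseteq> V \<and> h ` (V - A) \<subseteq> U \<and> b \<notin> closure U" if K: "K \<in> components A" for K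
  proof -
    obtain G where "open G" "K \<subseteq> G" "G \<inter> A = K" by (rule finite_components_open_nbhd[OF A(1,3) K])
    then obtain M where M: "M \<in> components B" "ends_to h A K M"
      using ends_to_component[OF A(1,2) K _ _ B h] by blast
    have "M \<noteq> L" using neg witness K M by blast
    then have "b \<notin> M" using b disjoint_components M L by blast
    then obtain U1 U2 where U: "open U1" "open U2" "b \<in> U1" "M \<subseteq> U2" "U1 \<inter> U2 = {}"
      using separate_point_compact compact_component[OF B M(1)] by metis
    have "b \<notin> closure U2" using U open_Int_closure_eq_empty[of U1 U2] by blast
    then show ?thesis using ends_toE[OF M(2) U(2,4)] U(2) by metis
  qed
  then obtain U V where UV: "\<And>K. K \<in> components A \<Longrightarrow> open (U K) \<and> open (V K) \<and> K \<subseteq> V K \<and> h ` (V K - A) \<subseteq> U K \<and> b \<notin> closure (U K)"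
    by metis
  define V' where "V' = (\<Union>K\<in>components A. V K)"
  have "open V'" using UV by (auto simp: V'_def)
  moreover have "A \<subseteq> V'"
  proof
    fix x assume "x \<in> A"
    then obtain K where K: "K \<in> components A" "x \<in> K" using Union_components[of A] by blast
    then show "x \<in> V'" using UV[OF K(1)] by (auto simp: V'_def)
  qed
  ultimately obtain Q where Q: "open Q" "B \<subseteq> Q" "g ` (Q - B) \<subseteq> V'"
    by (rule ends_toE[OF g(3)])
  define Z where "Z = Q - (\<Union>K\<in>components A. closure (U K))"
  have "closed (\<Union>K\<in>components A. closure (U K))" using A(3) by (intro closed_UN) auto
  then have "open Z" using Q by (auto simp: Z_def)
  have "b \<in> Q" using b L in_components_subset Q by blast
  then have Z: "open Z" "b \<in> Z" using UV \<open>open Z\<close> by (auto simp: Z_def)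
  obtain y where y: "y \<in> Z" "y \<notin> B" using closure_Compl_meets[OF b(2) Z] by blast
  then have "g y \<in> V' - A" using Q g(1) by (auto simp: Z_def)
  then obtain K where K: "K \<in> components A" "g y \<in> V K - A" by (auto simp: V'_def)
  then have "y \<in> U K" using UV[OF K(1)] g(2)[OF y(2)] by force
  then show False using y K closure_subset by (fastforce simp: Z_def)
qed

text \<open>A point near \<open>K\<close> goes near \<open>M\<close> under \<open>h\<close> and then
  near \<open>L\<close> under \<open>g\<close>, although \<open>g\<close> undoes \<open>h\<close>;
  disjoint neighbourhoods of \<open>K\<close> and \<open>L\<close> exclude this.\<close>

lemma ends_to_id_eq:
  assumes "compact A" "K \<in> components A" "L \<in> components A"
    and "ends_to h A K M" "ends_to g B M L" "\<And>x. x \<notin> A \<Longrightarrow> h x \<notin> B \<and> g (h x) = x"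
  shows "K = L"
proof (rule ccontr)
  assume "K \<noteq> L"
  then obtain U1 U2 where U: "open U1" "open U2" "K \<subseteq> U1" "L \<subseteq> U2" "U1 \<inter> U2 = {}"
    using separate_components assms(1-3) by metis
  then obtain V where V: "open V" "M \<subseteq> V" "g ` (V - B) \<subseteq> U2" using ends_toE[OF assms(5) U(2,4)] by blast
  then obtain W where W: "open W" "K \<subseteq> W" "h ` (W - A) \<subseteq> V" using ends_toE[OF assms(4) V(1,2)] by blast
  obtain a where a: "a \<in> K" "a \<in> closure (- A)" using component_frontier_point assms by blast
  have "open (W \<inter> U1)" "a \<in> W \<inter> U1" using W U a by auto
  then obtain x where x: "x \<in> W \<inter> U1" "x \<notin> A" using closure_Compl_meets[OF a(2)] by blast
  then have "h x \<in> V - B" using W assms(6) by blast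
  then have "x \<in> U2" using V assms(6)[OF x(2)] by force
  then show False using x U by blast
qed

text \<open>Finiteness is assumed for \<open>A\<close> only. Choosing for each \<open>L\<close> a
  component \<open>k L\<close> that goes to it is injective, so \<open>B\<close> has finitely many
  components too; from then on the roles of \<open>A\<close> and \<open>B\<close> can be
  exchanged.\<close>

theorem components_correspond:
  assumes A: "compact A" "connected (- A)" "finite (components A)"
    and B: "compact B" and h: "continuous_on (- A) h" "ends_to h A A B"
    and g: "continuous_on (- B) g" "ends_to g B B A"
    and hg: "\<And>x. x \<notin> A \<Longrightarrow> h x \<notin> B \<and> g (h x) = x" and gh: "\<And>y. y \<notin> B \<Longrightarrow> g y \<notin> A \<and> h (g y) = y"
  shows "finite (components B)"
    and "L \<in> components B \<Longrightarrow> \<exists>K\<in>components A. ends_to h A K L \<and> ends_to g B L K"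
    and "K \<in> components A \<Longrightarrow> \<exists>L\<in>components B. ends_to h A K L \<and> ends_to g B L K"
proof -
  have "\<exists>K. K \<in> components A \<and> ends_to h A K L" if L: "L \<in> components B" for L
  proof -
    have "h ` (- A) \<subseteq> - B" "g ` (- B) \<subseteq> - A" using hg gh by auto
    from ends_to_component_onto[OF A B h(1) this(1) h(2) this(2) _ g(2) L] show ?thesis
      using gh by blast
  qed
  then obtain k where k: "\<And>L. L \<in> components B \<Longrightarrow> k L \<in> components A \<and> ends_to h A (k L) L" by metis
  have uniq: "L = M" if q: "L \<in> components B" "M \<in> components B" "K \<in> components A"
    "ends_to h A K L" "ends_to h A K M" for K L M
  proof (rule ccontr)
    assume "L \<noteq> M"
    then obtain U1 U2 where U: "open U1" "open U2" "L \<subseteq> U1" "M \<subseteq> U2" "U1 \<inter> U2 = {}"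
      using separate_components[OF B q(1,2) \<open>L \<noteq> M\<close>] by metis
    then obtain V W where V: "open V" "K \<subseteq> V" "h ` (V - A) \<subseteq> U1" and W: "open W" "K \<subseteq> W" "h ` (W - A) \<subseteq> U2"
      using ends_toE[OF q(4) U(1,3)] ends_toE[OF q(5) U(2,4)] by metis
    obtain a where a: "a \<in> K" "a \<in> closure (- A)" using component_frontier_point[OF A(1) q(3)] by blast
    have "open (W \<inter> V)" "a \<in> W \<inter> V" using W V a by auto
    then obtain x where x: "x \<in> W \<inter> V" "x \<notin> A" using closure_Compl_meets[OF a(2)] by blast
    then show False using U V W by blast
  qed
  have "inj_on k (components B)"
    by (intro inj_onI) (metis k uniq)
  moreover have "k ` components B \<subseteq> components A" using k by blast
  ultimately show finB: "finite (components B)" using A(3) finite_imageD finite_subset by metis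
  have cB: "connected (- B)"
  proof -
    have "- B = h ` (- A)" using hg gh by force
    then show ?thesis using A h connected_continuous_image by metis
  qed
  \<comment> \<open>Now \<open>g\<close> sends \<open>L\<close> to some component \<open>K'\<close>,
    and going forth and back identifies \<open>K'\<close> with \<open>K\<close>.\<close>
  have reverse: "ends_to g B L K" if L: "L \<in> components B" and K: "K \<in> components A" and KL: "ends_to h A K L" for K L
  proof -
    obtain G where "open G" "L \<subseteq> G" "G \<inter> B = L" by (rule finite_components_open_nbhd[OF B finB L])
    then obtain K' where K': "K' \<in> components A" "ends_to g B L K'"
      using ends_to_component[OF B cB L _ _ A(1) g(1) _ g(2)] gh by blast
    have "K = K'" using ends_to_id_eq[OF A(1) K K'(1) KL K'(2)] hg by blast
    then show ?thesis using K' by blast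
  qed
  show "\<exists>K\<in>components A. ends_to h A K L \<and> ends_to g B L K" if "L \<in> components B" for L
    using k[OF that] reverse[OF that] by blast
  show "\<exists>L\<in>components B. ends_to h A K L \<and> ends_to g B L K" if K: "K \<in> components A" for K
  proof -
    obtain G where "open G" "K \<subseteq> G" "G \<inter> A = K" by (rule finite_components_open_nbhd[OF A(1,3) K])
    then obtain L where "L \<in> components B" "ends_to h A K L"
      using ends_to_component[OF A(1,2) K _ _ B h(1) _ h(2)] hg by blast
    then show ?thesis using reverse K by blast
  qed
qed

subsection \<open>Inversion at a point of the domain\<close>

text \<open>The image of the complement of \<open>S\<close> in the Riemann sphere under \<open>x \<mapsto> 1/(x - p)\<close>, which is compact
  in the plane if \<open>p\<close> is interior to \<open>S\<close>.  The point at infinity goes to 0; the case \<open>w = 0\<close> is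
  separate because \<open>inverse 0 = 0\<close>.\<close>

definition icompl :: "complex \<Rightarrow> complex set \<Rightarrow> complex set" where
  "icompl p S = {w. w = 0 \<or> p + inverse w \<notin> S}"

text \<open>The map \<open>f\<close> after the inversions at \<open>p\<close> and at \<open>f p\<close>.\<close>

definition invert_conj :: "(complex \<Rightarrow> complex) \<Rightarrow> complex \<Rightarrow> complex \<Rightarrow> complex" where
  "invert_conj f p w = inverse (f (p + inverse w) - f p)"

text \<open>Convergence of \<open>s\<close> to the subset \<open>K\<close> of the plane after the inversion at \<open>p\<close>.\<close>

definition inv_tends :: "complex \<Rightarrow> (nat \<Rightarrow> complex) \<Rightarrow> complex set \<Rightarrow> bool" where
  "inv_tends p s K \<longleftrightarrow>
     (\<forall>U. open U \<and> K \<subseteq> U \<longrightarrow> (\<forall>\<^sub>F k in sequentially. s k \<noteq> p \<and> inverse (s k - p) \<in> U))"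

lemma Compl_icompl: "- icompl p S = {w. w \<noteq> 0 \<and> p + inverse w \<in> S}"
  by (auto simp: icompl_def)

lemma Compl_icompl_image: "- icompl p S = (\<lambda>x. inverse (x - p)) ` (S - {p})"
proof -
  have "w \<in> (\<lambda>x. inverse (x - p)) ` (S - {p})" if "w \<noteq> 0" "p + inverse w \<in> S" for w
    using that by (intro image_eqI[of _ _ "p + inverse w"]) auto
  then show ?thesis by (auto simp: Compl_icompl)
qed

lemma zero_in_icompl [simp]: "0 \<in> icompl p S"
  by (simp add: icompl_def)

lemma inverse_in_icompl [simp]: "x \<noteq> p \<Longrightarrow> inverse (x - p) \<in> icompl p S \<longleftrightarrow> x \<notin> S"
  by (auto simp: icompl_def)

lemma closed_icompl:
  assumes "open S" shows "closed (icompl p S)"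
proof -
  have "open ((\<lambda>w. p + inverse w) -` S \<inter> (- {0}))"
    by (rule continuous_on_open_vimage[THEN iffD1, rule_format]) (auto intro!: continuous_intros assms)
  moreover have "- icompl p S = (\<lambda>w. p + inverse w) -` S \<inter> (- {0})" by (auto simp: Compl_icompl)
  ultimately show ?thesis by (simp add: closed_def)
qed

lemma compact_icompl:
  assumes "open S" "p \<in> S" shows "compact (icompl p S)"
proof -
  obtain e where e: "e > 0" "ball p e \<subseteq> S" using assms openE by blast
  have "icompl p S \<subseteq> cball 0 (inverse e)"
  proof
    fix w assume w: "w \<in> icompl p S"
    show "w \<in> cball 0 (inverse e)"
    proof (cases "w = 0")
      case False
      then have "p + inverse w \<notin> ball p e" using w e by (auto simp: icompl_def)
      then have "e \<le> inverse (norm w)" by (simp add: dist_norm norm_inverse)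
      then show ?thesis using e False by (simp add: field_simps)
    qed (use e in simp)
  qed
  then show ?thesis
    using closed_icompl[OF assms(1)] bounded_subset[OF bounded_cball] compact_eq_bounded_closed by blast
qed

text \<open>Inversion is discontinuous at 0, but \<open>T\<close> lies in a ball of radius
  \<open>R\<close> about \<open>p\<close>, so the complement of the set keeps distance
  \<open>inverse R\<close> from 0 and is a closed preimage under a continuous map.\<close>

lemma open_icompl:
  assumes "compact T" shows "open (icompl p T)"
proof -
  obtain R where R: "R > 0" "T \<subseteq> ball p R" using bounded_subset_ballD[OF compact_imp_bounded[OF assms]] by blast
  let ?C = "- ball (0::complex) (inverse R)"
  have eq: "- icompl p T = ?C \<inter> (\<lambda>w. p + inverse w) -` T"
  proof (intro set_eqI iffI)
    fix w assume w: "w \<in> - icompl p T"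
    then have "w \<noteq> 0" "p + inverse w \<in> ball p R" using R by (auto simp: Compl_icompl)
    then have "inverse (norm w) < R" by (simp add: dist_norm norm_inverse)
    then have "inverse R \<le> norm w" using R \<open>w \<noteq> 0\<close> by (simp add: field_simps)
    then show "w \<in> ?C \<inter> (\<lambda>w. p + inverse w) -` T" using w by (auto simp: Compl_icompl)
  next
    fix w assume w: "w \<in> ?C \<inter> (\<lambda>w. p + inverse w) -` T"
    then have "inverse R \<le> norm w" by simp
    then have "w \<noteq> 0" using R by (metis inverse_positive_iff_positive norm_zero not_le)
    then show "w \<in> - icompl p T" using w by (auto simp: Compl_icompl)
  qed
  have "continuous_on ?C (\<lambda>w. p + inverse w)"
    using R by (intro continuous_intros) auto
  then have "closed (?C \<inter> (\<lambda>w. p + inverse w) -` T)"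
    by (rule continuous_closed_preimage) (auto intro: compact_imp_closed assms)
  then show ?thesis using eq by (metis open_closed)
qed

lemma connected_Compl_icompl:
  assumes "open S" "connected S" shows "connected (- icompl p S)"
  unfolding Compl_icompl_image
  by (intro connected_continuous_image continuous_intros connected_open_delete assms) auto

text \<open>A homeomorphism is proper: points leaving every compact subset of \<open>S\<close> have
  images leaving every compact subset of \<open>T\<close>.\<close>

lemma ends_to_invert_conj:
  assumes S: "open S" "p \<in> S" and T: "open T" and fg: "homeomorphism S T f g"
  shows "ends_to (invert_conj f p) (icompl p S) (icompl p S) (icompl (f p) T)"
  unfolding ends_to_def
proof (intro allI impI, elim conjE)
  fix U assume U: "open U" "icompl (f p) T \<subseteq> U"
  have U0: "0 \<in> U" using U zero_in_icompl by blast
  \<comment> \<open>The translate of \<open>icompl 0 U\<close> by \<open>f p\<close> is the compact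
    set of points that the inversion at \<open>f p\<close> does not carry into \<open>U\<close>; it
    includes \<open>f p\<close> itself, which goes to infinity.\<close>
  define Q where "Q = (\<lambda>w. f p + w) ` icompl 0 U"
  have "compact Q" unfolding Q_def
    by (intro compact_continuous_image continuous_intros compact_icompl U U0)
  have QT: "Q \<subseteq> T"
  proof
    fix y assume "y \<in> Q"
    then have y: "y - f p = 0 \<or> inverse (y - f p) \<notin> U" by (auto simp: Q_def icompl_def)
    show "y \<in> T"
    proof (cases "y = f p")
      case True then show ?thesis using S fg by (auto simp: homeomorphism_def)
    next
      case False
      then have "inverse (y - f p) \<notin> icompl (f p) T" using y False subsetD[OF U(2), of "inverse (y - f p)"] by auto
      then show ?thesis using False by (metis inverse_in_icompl)
    qed
  qed
  define Z where "Z = g ` Q"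
  have Z: "compact Z" unfolding Z_def
    using fg QT by (intro compact_continuous_image \<open>compact Q\<close>) (auto simp: homeomorphism_def intro: continuous_on_subset)
  have ZS: "Z \<subseteq> S" using QT fg by (auto simp: Z_def homeomorphism_def)
  show "\<exists>V. open V \<and> icompl p S \<subseteq> V \<and> invert_conj f p ` (V - icompl p S) \<subseteq> U"
  proof (intro exI conjI)
    show "open (icompl p Z)" using open_icompl Z .
    show "icompl p S \<subseteq> icompl p Z" using ZS by (auto simp: icompl_def)
    show "invert_conj f p ` (icompl p Z - icompl p S) \<subseteq> U"
    proof clarify
      fix w assume w: "w \<in> icompl p Z" "w \<notin> icompl p S"
      then have x: "w \<noteq> 0" "p + inverse w \<in> S" "p + inverse w \<notin> Z" by (auto simp: icompl_def)
      have "f (p + inverse w) \<notin> Q"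
      proof
        assume "f (p + inverse w) \<in> Q"
        then have "g (f (p + inverse w)) \<in> Z" by (simp add: Z_def)
        then show False using x fg by (simp add: homeomorphism_def)
      qed
      then have "f (p + inverse w) - f p \<notin> icompl 0 U" unfolding Q_def
        by (metis add.commute diff_add_cancel image_eqI)
      then show "invert_conj f p w \<in> U" by (auto simp: invert_conj_def icompl_def)
    qed
  qed
qed

lemma invert_conj_maps:
  assumes S: "p \<in> S" and fg: "homeomorphism S T f g" and w: "w \<notin> icompl p S"
  shows "invert_conj f p w \<notin> icompl (f p) T \<and> invert_conj g (f p) (invert_conj f p w) = w"
proof -
  have x: "w \<noteq> 0" "p + inverse w \<in> S" using w by (auto simp: icompl_def)
  have g: "g (f x) = x" if "x \<in> S" for x using fg that by (auto simp: homeomorphism_def)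
  have ne: "f (p + inverse w) \<noteq> f p" using g[OF x(2)] g[OF S] x(1) by auto
  have "f (p + inverse w) \<in> T" using fg x by (auto simp: homeomorphism_def)
  then show ?thesis using ne g x S by (auto simp: invert_conj_def)
qed

lemma continuous_on_invert_conj:
  assumes S: "p \<in> S" and fg: "homeomorphism S T f g"
  shows "continuous_on (- icompl p S) (invert_conj f p)"
proof -
  have "continuous_on S f" using fg by (auto simp: homeomorphism_def)
  moreover have "continuous_on (- icompl p S) (\<lambda>w. p + inverse w)"
    by (intro continuous_intros) (auto simp: Compl_icompl)
  moreover have "(\<lambda>w. p + inverse w) ` (- icompl p S) \<subseteq> S" by (auto simp: Compl_icompl)
  ultimately have "continuous_on (- icompl p S) (\<lambda>w. f (p + inverse w))"
    by (rule continuous_on_compose2)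
  moreover have "f (p + inverse w) - f p \<noteq> 0" if "w \<in> - icompl p S" for w
  proof -
    have "invert_conj f p w \<noteq> 0" using invert_conj_maps[OF S fg] that zero_in_icompl by (metis ComplD)
    then show ?thesis by (auto simp: invert_conj_def)
  qed
  ultimately show ?thesis
    unfolding invert_conj_def by (intro continuous_on_inverse continuous_on_diff continuous_on_const) auto
qed

lemma inv_tends_image:
  assumes e: "ends_to (invert_conj f p) (icompl p S) K L" and f: "inj_on f S" "p \<in> S"
    and s: "range s \<subseteq> S" "inv_tends p s K"
  shows "inv_tends (f p) (f \<circ> s) L"
  unfolding inv_tends_def
proof (intro allI impI, elim conjE)
  fix U assume "open U" "L \<subseteq> U"
  then obtain V where V: "open V" "K \<subseteq> V" "invert_conj f p ` (V - icompl p S) \<subseteq> U"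
    by (rule ends_toE[OF e])
  have "\<forall>\<^sub>F k in sequentially. s k \<noteq> p \<and> inverse (s k - p) \<in> V"
    using s(2) V unfolding inv_tends_def by blast
  then show "\<forall>\<^sub>F k in sequentially. (f \<circ> s) k \<noteq> f p \<and> inverse ((f \<circ> s) k - f p) \<in> U"
  proof eventually_elim
    case (elim k)
    have sk: "s k \<in> S" using s by auto
    then have "inverse (s k - p) \<in> V - icompl p S" using elim by auto
    then have "invert_conj f p (inverse (s k - p)) \<in> U" using V by blast
    then show ?case using elim sk f by (auto simp: invert_conj_def inj_on_def)
  qed
qed

text \<open>\<open>ends_to\<close> in both directions makes convergence of sequences to
  \<open>K\<close> equivalent to convergence of their images to \<open>L\<close>. The last part
  keeps the \<open>ends_to\<close> statement because the logarithms near the slits need control on a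
  whole neighbourhood.\<close>

theorem end_correspondence:
  assumes S: "open S" "connected S" "p \<in> S" and T: "open T" and fg: "homeomorphism S T f g"
    and fin: "finite (components (icompl p S))"
  shows "finite (components (icompl (f p) T))"
    and "L \<in> components (icompl (f p) T) \<Longrightarrow> \<exists>K\<in>components (icompl p S).
           \<forall>s. range s \<subseteq> S \<longrightarrow> (inv_tends p s K \<longleftrightarrow> inv_tends (f p) (f \<circ> s) L)"
    and "K \<in> components (icompl p S) \<Longrightarrow> \<exists>L\<in>components (icompl (f p) T).
           ends_to (invert_conj f p) (icompl p S) K L \<and>
           (\<forall>s. range s \<subseteq> S \<longrightarrow> (inv_tends p s K \<longleftrightarrow> inv_tends (f p) (f \<circ> s) L))"
proof -
  have gf: "homeomorphism T S g f" using fg by (rule homeomorphism_symD)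
  have p': "f p \<in> T" "g (f p) = p" using fg S by (auto simp: homeomorphism_def)
  have A: "compact (icompl p S)" "connected (- icompl p S)"
    using S by (auto intro: compact_icompl connected_Compl_icompl)
  have B: "compact (icompl (f p) T)" using T p' by (auto intro: compact_icompl)
  have eg: "ends_to (invert_conj g (f p)) (icompl (f p) T) (icompl (f p) T) (icompl p S)"
    using ends_to_invert_conj[OF T p'(1) S(1) gf] p' by simp
  have hg: "invert_conj f p x \<notin> icompl (f p) T \<and> invert_conj g (f p) (invert_conj f p x) = x"
    if "x \<notin> icompl p S" for x using invert_conj_maps[OF S(3) fg that] .
  have gh: "invert_conj g (f p) y \<notin> icompl p S \<and> invert_conj f p (invert_conj g (f p) y) = y"
    if "y \<notin> icompl (f p) T" for y using invert_conj_maps[OF p'(1) gf that] p' by simp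
  note cc = components_correspond[OF A fin B continuous_on_invert_conj[OF S(3) fg]
      ends_to_invert_conj[OF S(1,3) T fg] continuous_on_invert_conj[OF p'(1) gf] eg]
  have inj: "inj_on f S" "inj_on g T" using fg gf by (metis homeomorphism_def inj_on_inverseI)+
  have iff: "\<forall>s. range s \<subseteq> S \<longrightarrow> (inv_tends p s K \<longleftrightarrow> inv_tends (f p) (f \<circ> s) L)"
    if "ends_to (invert_conj f p) (icompl p S) K L" "ends_to (invert_conj g (f p)) (icompl (f p) T) L K" for K L
  proof (intro allI impI iffI)
    fix s :: "nat \<Rightarrow> complex" assume s: "range s \<subseteq> S"
    show "inv_tends (f p) (f \<circ> s) L" if "inv_tends p s K"
      using inv_tends_image[OF \<open>ends_to (invert_conj f p) _ K L\<close> inj(1) S(3) s that] .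
    assume t: "inv_tends (f p) (f \<circ> s) L"
    have r: "range (f \<circ> s) \<subseteq> T" using s fg by (auto simp: homeomorphism_def)
    have "g \<circ> (f \<circ> s) = s" using s fg by (auto simp: homeomorphism_def fun_eq_iff)
    then show "inv_tends p s K"
      using inv_tends_image[OF \<open>ends_to (invert_conj g (f p)) _ L K\<close> inj(2) p'(1) r t] p' by simp
  qed
  show "finite (components (icompl (f p) T))" by (rule cc(1)) (use hg gh in auto)
  show "\<exists>K\<in>components (icompl p S). \<forall>s. range s \<subseteq> S \<longrightarrow> (inv_tends p s K \<longleftrightarrow> inv_tends (f p) (f \<circ> s) L)"
    if "L \<in> components (icompl (f p) T)"
  proof -
    have "\<exists>K\<in>components (icompl p S). ends_to (invert_conj f p) (icompl p S) K L \<and>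
        ends_to (invert_conj g (f p)) (icompl (f p) T) L K"
      by (rule cc(2)) (use hg gh that in auto)
    then show ?thesis using iff by meson
  qed
  show "\<exists>L\<in>components (icompl (f p) T). ends_to (invert_conj f p) (icompl p S) K L \<and>
           (\<forall>s. range s \<subseteq> S \<longrightarrow> (inv_tends p s K \<longleftrightarrow> inv_tends (f p) (f \<circ> s) L))"
    if "K \<in> components (icompl p S)"
  proof -
    have "\<exists>L\<in>components (icompl (f p) T). ends_to (invert_conj f p) (icompl p S) K L \<and>
        ends_to (invert_conj g (f p)) (icompl (f p) T) L K"
      by (rule cc(3)) (use hg gh that in auto)
    then show ?thesis using iff by meson
  qed
qed

section \<open>Sequences approaching complementary components and their frontiers\<close>

lemma inv_tends_exists:
  assumes S: "open S" "p \<in> S" and K: "K \<in> components (icompl p S)"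
  obtains s where "range s \<subseteq> S" "inv_tends p s K"
proof -
  obtain a where a: "a \<in> K" "a \<in> closure (- icompl p S)"
    using component_frontier_point[OF compact_icompl[OF S] K] by blast
  then obtain w where w: "\<And>n. w n \<in> - icompl p S" "w \<longlonglongrightarrow> a" using closure_sequential by blast
  define s where "s n = p + inverse (w n)" for n
  have "range s \<subseteq> S" "\<And>n. s n \<noteq> p" "\<And>n. inverse (s n - p) = w n"
    using w by (auto simp: s_def Compl_icompl)
  moreover have "inv_tends p s K" unfolding inv_tends_def
  proof (intro allI impI, elim conjE)
    fix U assume "open U" "K \<subseteq> U"
    then have "\<forall>\<^sub>F k in sequentially. w k \<in> U" using topological_tendstoD[OF w(2)] a by blast
    then show "\<forall>\<^sub>F k in sequentially. s k \<noteq> p \<and> inverse (s k - p) \<in> U"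
      by eventually_elim (use calculation in auto)
  qed
  ultimately show ?thesis using that by blast
qed

lemma inv_tends_disjoint:
  assumes "inv_tends p s K" "inv_tends p s L" "compact K" "compact L"
  shows "K \<inter> L \<noteq> {}"
proof
  assume "K \<inter> L = {}"
  then obtain U V where U: "open U" "open V" "K \<subseteq> U" "L \<subseteq> V" "U \<inter> V = {}"
    using separation_normal_compact[of K L] assms compact_imp_closed by metis
  have "\<forall>\<^sub>F k in sequentially. inverse (s k - p) \<in> U \<and> inverse (s k - p) \<in> V"
    using assms(1,2) U unfolding inv_tends_def by (auto simp: eventually_conj_iff)
  then show False using U eventually_happens by (metis (no_types, lifting) disjoint_iff sequentially_bot)
qed

text \<open>Inverted points of \<open>S\<close> lie outside \<open>K\<close>, so adding
  \<open>interior K\<close> to a neighbourhood of \<open>frontier K\<close> catches no further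
  terms. This links boundary components, which are frontiers, to complementary components.\<close>

lemma inv_tends_frontier:
  assumes s: "range s \<subseteq> S" and K: "K \<subseteq> icompl p S" "closed K"
  shows "inv_tends p s (frontier K) \<longleftrightarrow> inv_tends p s K"
proof
  assume "inv_tends p s (frontier K)"
  then show "inv_tends p s K"
    unfolding inv_tends_def using K frontier_subset_closed by (meson subset_trans)
next
  assume t: "inv_tends p s K"
  show "inv_tends p s (frontier K)" unfolding inv_tends_def
  proof (intro allI impI, elim conjE)
    fix U assume U: "open U" "frontier K \<subseteq> U"
    have "open (U \<union> interior K)" using U by auto
    moreover have "K \<subseteq> U \<union> interior K" using U K by (auto simp: frontier_def)
    ultimately have "\<forall>\<^sub>F k in sequentially. s k \<noteq> p \<and> inverse (s k - p) \<in> U \<union> interior K"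
      using t unfolding inv_tends_def by blast
    then show "\<forall>\<^sub>F k in sequentially. s k \<noteq> p \<and> inverse (s k - p) \<in> U"
    proof eventually_elim
      case (elim k)
      then have "inverse (s k - p) \<notin> K" using K s by (metis inverse_in_icompl range_subsetD subsetD)
      then show ?case using elim interior_subset by blast
    qed
  qed
qed

text \<open>\<open>K\<close> and \<open>- K\<close> are both connected, hence so is
  \<open>frontier K\<close>. It lies in \<open>frontier A\<close> and contains \<open>T\<close>, so
  maximality of \<open>T\<close> gives equality.\<close>

lemma components_frontier:
  fixes A :: "'a::euclidean_space set"
  assumes A: "compact A" "connected (- A)" and T: "T \<in> components (frontier A)"
  obtains K where "K \<in> components A" "T = frontier K"
proof -
  have cl: "closed A" using A compact_imp_closed by blast
  obtain x where x: "x \<in> T" using T in_components_nonempty by blast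
  have TA: "T \<subseteq> frontier A" "T \<subseteq> A" using T in_components_subset frontier_subset_closed[OF cl] by blast+
  define K where "K = connected_component_set A x"
  have K: "K \<in> components A" using x TA by (auto simp: K_def componentsI)
  have TK: "T \<subseteq> K"
    unfolding K_def using in_components_connected[OF T] x TA by (intro connected_component_maximal) auto
  have fK: "frontier K \<subseteq> frontier A" using frontier_of_components_subset[OF K] .
  have clK: "closed K" using closed_components cl K by blast
  have "T \<subseteq> frontier K"
  proof
    fix y assume y: "y \<in> T"
    have "y \<in> closure (- A)" using y TA by (auto simp: frontier_closures)
    then have "y \<in> closure (- K)" using closure_mono[of "-A" "-K"] in_components_subset[OF K] by blast
    then show "y \<in> frontier K" using y TK closure_subset by (auto simp: frontier_closures)
  qed
  moreover have "connected (frontier K)"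
    using connected_frontier_simple in_components_connected[OF K] component_complement_connected[of "- A" K] A K by simp
  ultimately have "frontier K = T"
    using T fK in_components_maximal[of T "frontier A"] x by blast
  then show ?thesis using that K by blast
qed

subsection \<open>The Riemann sphere\<close>

text \<open>The chart of the sphere that moves \<open>Some p\<close> to infinity. At
  \<open>Some p\<close> the formula gives the default value \<open>inverse 0 = 0\<close>, which
  collides with the image of \<open>None\<close>, so that point is excluded where injectivity
  matters.\<close>

definition sphere_inv :: "complex \<Rightarrow> complex option \<Rightarrow> complex" where
  "sphere_inv p x = (case x of None \<Rightarrow> 0 | Some y \<Rightarrow> inverse (y - p))"

lemma sphere_inv_simps [simp]: "sphere_inv p None = 0" "sphere_inv p (Some y) = inverse (y - p)"
  by (auto simp: sphere_inv_def)

text \<open>The closedness that the general compactification asks of complements of neighbourhoods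
  of infinity is automatic for compact sets in the plane.\<close>

lemma openin_riemann_sphere:
  "openin riemann_sphere U \<longleftrightarrow> open (Some -` U) \<and> (None \<in> U \<longrightarrow> compact (- (Some -` U)))"
proof -
  have 1: "(\<exists>V. open V \<and> U = Some ` V) \<longleftrightarrow> open (Some -` U) \<and> None \<notin> U"
  proof
    assume "open (Some -` U) \<and> None \<notin> U"
    moreover have "U = Some ` (Some -` U)" if "None \<notin> U"
      using that by (auto simp: image_iff) (metis not_None_eq)
    ultimately show "\<exists>V. open V \<and> U = Some ` V" by blast
  qed (auto simp: inj_vimage_image_eq)
  have 2: "(\<exists>C. compact C \<and> closed C \<and> U = insert None (Some ` (- C))) \<longleftrightarrow> None \<in> U \<and> compact (- (Some -` U))"
  proof
    assume "None \<in> U \<and> compact (- (Some -` U))"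
    moreover have "U = insert None (Some ` (- (- (Some -` U))))" if "None \<in> U"
      using that by (auto simp: image_iff)
    ultimately show "\<exists>C. compact C \<and> closed C \<and> U = insert None (Some ` (- C))"
      using compact_imp_closed by blast
  next
    assume "\<exists>C. compact C \<and> closed C \<and> U = insert None (Some ` (- C))"
    then obtain C where C: "compact C" "U = insert None (Some ` (- C))" by blast
    have "- (Some -` U) = C" using C by auto
    then show "None \<in> U \<and> compact (- (Some -` U))" using C by auto
  qed
  show ?thesis
    unfolding riemann_sphere_def openin_Alexandroff_compactification
    using 1 2 compact_imp_closed[of "- (Some -` U)"]
    by (auto simp: Compl_eq_Diff_UNIV[symmetric] open_closed)
qed

lemma topspace_riemann_sphere [simp]: "topspace riemann_sphere = UNIV"
  by (auto simp: riemann_sphere_def UNIV_option_conv)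

text \<open>If \<open>V\<close> contains 0, the set is a neighbourhood of infinity, and its
  complement in the plane is the compact set \<open>icompl 0 V\<close> shifted by
  \<open>p\<close>.\<close>

lemma openin_sphere_inv_vimage:
  assumes "open V" shows "openin riemann_sphere {x. x \<noteq> Some p \<and> sphere_inv p x \<in> V}"
proof -
  have eq: "Some -` {x. x \<noteq> Some p \<and> sphere_inv p x \<in> V} = (\<lambda>x. inverse (x - p)) -` V \<inter> (- {p})"
    by auto
  have "open ((\<lambda>x. inverse (x - p)) -` V \<inter> (- {p}))"
    by (rule continuous_on_open_vimage[THEN iffD1, rule_format]) (auto intro!: continuous_intros assms)
  moreover have "compact (- (Some -` {x. x \<noteq> Some p \<and> sphere_inv p x \<in> V}))" if "0 \<in> V"
  proof -
    have "- (Some -` {x. x \<noteq> Some p \<and> sphere_inv p x \<in> V}) = (\<lambda>w. p + w) ` icompl 0 V"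
    proof (intro set_eqI)
      fix x
      have "x \<in> (\<lambda>w. p + w) ` icompl 0 V \<longleftrightarrow> x - p \<in> icompl 0 V"
        by (metis add_diff_cancel_left' diff_add_cancel add.commute image_iff)
      then show "x \<in> - (Some -` {x. x \<noteq> Some p \<and> sphere_inv p x \<in> V}) \<longleftrightarrow> x \<in> (\<lambda>w. p + w) ` icompl 0 V"
        by (auto simp: icompl_def)
    qed
    moreover have "compact ((\<lambda>w. p + w) ` icompl 0 V)"
      by (intro compact_continuous_image continuous_intros compact_icompl assms that)
    ultimately show ?thesis by simp
  qed
  ultimately show ?thesis unfolding openin_riemann_sphere using eq by simp
qed

lemma inj_on_sphere_inv: "inj_on (sphere_inv p) (- {Some p})"
  by (auto simp: inj_on_def sphere_inv_def split: option.splits)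

text \<open>The image is an \<open>icompl\<close> set or the complement of one, according to whether
  infinity belongs to \<open>U\<close>.\<close>

lemma open_sphere_inv_image:
  assumes "openin riemann_sphere U" shows "open (sphere_inv p ` (U - {Some p}))"
proof -
  have eq: "sphere_inv p ` (U - {Some p}) = (if None \<in> U then icompl p (- (Some -` U)) else - icompl p (Some -` U))"
  proof (intro set_eqI)
    fix w
    have "w \<in> sphere_inv p ` (U - {Some p}) \<longleftrightarrow> (w = 0 \<and> None \<in> U) \<or> (w \<noteq> 0 \<and> Some (p + inverse w) \<in> U)"
    proof
      assume "w \<in> sphere_inv p ` (U - {Some p})"
      then obtain x where "x \<in> U" "x \<noteq> Some p" "w = sphere_inv p x" by blast
      then show "(w = 0 \<and> None \<in> U) \<or> (w \<noteq> 0 \<and> Some (p + inverse w) \<in> U)" by (cases x) auto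
    next
      assume "(w = 0 \<and> None \<in> U) \<or> (w \<noteq> 0 \<and> Some (p + inverse w) \<in> U)"
      then show "w \<in> sphere_inv p ` (U - {Some p})"
        by (elim disjE) (force intro: image_eqI[of _ _ None], intro image_eqI[of _ _ "Some (p + inverse w)"], auto)
    qed
    then show "w \<in> sphere_inv p ` (U - {Some p}) \<longleftrightarrow>
      w \<in> (if None \<in> U then icompl p (- (Some -` U)) else - icompl p (Some -` U))"
      by (auto simp: icompl_def)
  qed
  show ?thesis
    unfolding eq using assms unfolding openin_riemann_sphere
    by (auto intro: open_icompl closed_icompl simp: open_Compl)
qed

lemma homeomorphic_map_sphere_inv:
  "homeomorphic_map (subtopology riemann_sphere (- {Some p})) euclidean (sphere_inv p)"
proof (rule bijective_open_imp_homeomorphic_map)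
  show "continuous_map (subtopology riemann_sphere (- {Some p})) euclidean (sphere_inv p)"
    unfolding continuous_map_def
  proof (intro conjI allI impI)
    fix V :: "complex set" assume "openin euclidean V"
    then have "openin riemann_sphere {x. x \<noteq> Some p \<and> sphere_inv p x \<in> V}" using openin_sphere_inv_vimage by auto
    moreover have "{x \<in> topspace (subtopology riemann_sphere (- {Some p})). sphere_inv p x \<in> V} = {x. x \<noteq> Some p \<and> sphere_inv p x \<in> V} \<inter> (- {Some p})"
      by auto
    ultimately show "openin (subtopology riemann_sphere (- {Some p})) {x \<in> topspace (subtopology riemann_sphere (- {Some p})). sphere_inv p x \<in> V}"
      unfolding openin_subtopology by blast
  qed auto
  show "open_map (subtopology riemann_sphere (- {Some p})) euclidean (sphere_inv p)"
    unfolding open_map_def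
  proof (intro allI impI)
    fix U assume "openin (subtopology riemann_sphere (- {Some p})) U"
    then obtain T where T: "openin riemann_sphere T" "U = T \<inter> - {Some p}" by (auto simp: openin_subtopology)
    show "openin euclidean (sphere_inv p ` U)" using open_sphere_inv_image[OF T(1), of p] T(2) by (simp add: Diff_eq)
  qed
  show "sphere_inv p ` topspace (subtopology riemann_sphere (- {Some p})) = topspace euclidean"
  proof -
    have "w \<in> sphere_inv p ` (- {Some p})" for w
      by (cases "w = 0") (force intro: image_eqI[of _ _ None], intro image_eqI[of _ _ "Some (p + inverse w)"], auto)
    then show ?thesis by auto
  qed
  show "inj_on (sphere_inv p) (topspace (subtopology riemann_sphere (- {Some p})))" using inj_on_sphere_inv by simp
qed

lemma components_eq_connected_components_of: "components S = connected_components_of (top_of_set S)"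
proof -
  have "connected_component_of (top_of_set S) x y \<longleftrightarrow> connected_component S x y" for x y
    unfolding connected_component_of_def connected_component_def by (auto simp: connectedin_subtopology)
  then show ?thesis
    by (auto simp: components_def connected_components_of_def)
qed

lemma sphere_components_sphere_inv:
  assumes "Some p \<notin> X"
  shows "components (sphere_inv p ` X) = image (sphere_inv p) ` sphere_components X"
proof -
  have X: "X \<subseteq> - {Some p}" using assms by auto
  have "homeomorphic_map (subtopology (subtopology riemann_sphere (- {Some p})) X)
          (subtopology euclidean (sphere_inv p ` X)) (sphere_inv p)"
    using X by (intro homeomorphic_map_subtopologies[OF homeomorphic_map_sphere_inv]) (simp add: Int_absorb1)
  moreover have "subtopology (subtopology riemann_sphere (- {Some p})) X = subtopology riemann_sphere X"
    using X by (simp add: subtopology_subtopology Int_absorb1)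
  ultimately show ?thesis
    unfolding sphere_components_def components_eq_connected_components_of
    by (metis homeomorphic_map_connected_components_of)
qed

lemma sphere_inv_image_complement:
  assumes "p \<in> S" shows "sphere_inv p ` (topspace riemann_sphere - Some ` S) = icompl p S"
proof (intro set_eqI iffI)
  fix w assume "w \<in> sphere_inv p ` (topspace riemann_sphere - Some ` S)"
  then obtain x where x: "x \<notin> Some ` S" "w = sphere_inv p x" by auto
  then show "w \<in> icompl p S" by (cases x) (auto simp: icompl_def)
next
  fix w assume w: "w \<in> icompl p S"
  show "w \<in> sphere_inv p ` (topspace riemann_sphere - Some ` S)"
  proof (cases "w = 0")
    case True then show ?thesis by (force intro: image_eqI[of _ _ None])
  next
    case False
    then show ?thesis using w
      by (intro image_eqI[of _ _ "Some (p + inverse w)"]) (auto simp: icompl_def)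
  qed
qed

text \<open>The chart is a homeomorphism only away from \<open>Some p\<close>, but \<open>p\<close>
  is interior to \<open>S\<close>, so at points outside \<open>S\<close> closures can be compared
  neighbourhood by neighbourhood. By openness of \<open>S\<close> the frontier is the closure with
  \<open>S\<close> removed.\<close>

lemma sphere_inv_image_frontier:
  assumes S: "open S" "p \<in> S"
  shows "sphere_inv p ` (riemann_sphere frontier_of (Some ` S)) = frontier (icompl p S)"
    and "Some p \<notin> riemann_sphere frontier_of (Some ` S)"
proof -
  have op: "openin riemann_sphere (Some ` S)"
    unfolding openin_riemann_sphere using S by (auto simp: inj_vimage_image_eq)
  have fr: "riemann_sphere frontier_of (Some ` S) = riemann_sphere closure_of (Some ` S) - Some ` S"
    using op by (simp add: frontier_of_def interior_of_openin)
  show p: "Some p \<notin> riemann_sphere frontier_of (Some ` S)" using fr S by auto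
  have frA: "frontier (icompl p S) = icompl p S \<inter> closure (- icompl p S)"
    using closed_icompl[OF S(1)] by (simp add: frontier_closures)
  have iff: "x \<in> riemann_sphere closure_of (Some ` S) \<longleftrightarrow> sphere_inv p x \<in> closure (- icompl p S)"
    if x: "x \<notin> Some ` S" for x
  proof
    have xp: "x \<noteq> Some p" using x S by auto
    assume cl: "x \<in> riemann_sphere closure_of (Some ` S)"
    show "sphere_inv p x \<in> closure (- icompl p S)"
      unfolding closure_iff_nhds_not_empty
    proof (intro allI impI)
      fix A V assume V: "V \<subseteq> A" "open V" "sphere_inv p x \<in> V"
      then have "x \<in> {x. x \<noteq> Some p \<and> sphere_inv p x \<in> V}" using xp by simp
      then obtain y where y: "y \<in> Some ` S" "y \<in> {x. x \<noteq> Some p \<and> sphere_inv p x \<in> V}"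
        using cl[unfolded in_closure_of, THEN conjunct2, rule_format, of "{x. x \<noteq> Some p \<and> sphere_inv p x \<in> V}"]
          openin_sphere_inv_vimage[OF V(2), of p] by blast
      then have "sphere_inv p y \<in> - icompl p S" by auto
      then show "- icompl p S \<inter> A \<noteq> {}" using y V by blast
    qed
  next
    have xp: "x \<noteq> Some p" using x S by auto
    assume cl: "sphere_inv p x \<in> closure (- icompl p S)"
    show "x \<in> riemann_sphere closure_of (Some ` S)"
      unfolding in_closure_of
    proof (intro conjI allI impI)
      fix U assume U: "x \<in> U \<and> openin riemann_sphere U"
      then have "open (sphere_inv p ` (U - {Some p}))" "sphere_inv p x \<in> sphere_inv p ` (U - {Some p})"
        using open_sphere_inv_image xp by auto
      then obtain w where w: "w \<in> sphere_inv p ` (U - {Some p})" "w \<notin> icompl p S"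
        using closure_Compl_meets[OF cl] by blast
      then obtain y where y: "y \<in> U" "y \<noteq> Some p" "w = sphere_inv p y" by blast
      then show "\<exists>y. y \<in> Some ` S \<and> y \<in> U" using w by (cases y) auto
    qed auto
  qed
  show "sphere_inv p ` (riemann_sphere frontier_of (Some ` S)) = frontier (icompl p S)"
  proof (intro set_eqI iffI)
    fix w assume "w \<in> sphere_inv p ` (riemann_sphere frontier_of (Some ` S))"
    then obtain x where x: "x \<notin> Some ` S" "x \<in> riemann_sphere closure_of (Some ` S)" "w = sphere_inv p x"
      using fr by auto
    have "w \<in> icompl p S" using x sphere_inv_image_complement[OF S(2)] by auto
    then show "w \<in> frontier (icompl p S)" using x iff frA by auto
  next
    fix w assume w: "w \<in> frontier (icompl p S)"
    then have "w \<in> sphere_inv p ` (topspace riemann_sphere - Some ` S)" using frA sphere_inv_image_complement[OF S(2)] by auto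
    then obtain x where "x \<notin> Some ` S" "w = sphere_inv p x" by auto
    then show "w \<in> sphere_inv p ` (riemann_sphere frontier_of (Some ` S))" using w iff frA fr by auto
  qed
qed

lemma tends_to_set_iff_inv_tends:
  assumes "Some p \<notin> G"
  shows "tends_to_set s G \<longleftrightarrow> inv_tends p s (sphere_inv p ` G)"
proof
  assume t: "tends_to_set s G"
  show "inv_tends p s (sphere_inv p ` G)" unfolding inv_tends_def
  proof (intro allI impI, elim conjE)
    fix V assume V: "open V" "sphere_inv p ` G \<subseteq> V"
    have "G \<subseteq> {x. x \<noteq> Some p \<and> sphere_inv p x \<in> V}" using V assms by auto
    then have "\<forall>\<^sub>F k in sequentially. Some (s k) \<in> {x. x \<noteq> Some p \<and> sphere_inv p x \<in> V}"
      using t openin_sphere_inv_vimage[OF V(1), of p] unfolding tends_to_set_def by blast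
    then show "\<forall>\<^sub>F k in sequentially. s k \<noteq> p \<and> inverse (s k - p) \<in> V" by simp
  qed
next
  assume t: "inv_tends p s (sphere_inv p ` G)"
  show "tends_to_set s G" unfolding tends_to_set_def
  proof (intro allI impI, elim conjE)
    fix U assume U: "openin riemann_sphere U" "G \<subseteq> U"
    have "sphere_inv p ` G \<subseteq> sphere_inv p ` (U - {Some p})" using U assms by blast
    then have "\<forall>\<^sub>F k in sequentially. s k \<noteq> p \<and> inverse (s k - p) \<in> sphere_inv p ` (U - {Some p})"
      using t open_sphere_inv_image[OF U(1)] unfolding inv_tends_def by blast
    then show "\<forall>\<^sub>F k in sequentially. Some (s k) \<in> U"
    proof eventually_elim
      case (elim k)
      then obtain x where x: "x \<in> U" "x \<noteq> Some p" "sphere_inv p (Some (s k)) = sphere_inv p x" by auto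
      then have "Some (s k) = x" using inj_onD[OF inj_on_sphere_inv x(3)] elim by auto
      then show ?case using x by simp
    qed
  qed
qed

subsection \<open>Slits and inscribed discs\<close>

text \<open>A path in \<open>- K\<close> from 0 to the exterior of a large disc, together with that
  exterior, is a closed connected set \<open>T\<close> through 0. The component of
  \<open>- T\<close> around \<open>K\<close> is simply connected and misses 0.\<close>

lemma continuous_log_near_compact:
  assumes K: "compact K" "connected K" "connected (- K)" "(0::complex) \<notin> K"
  obtains V l where "open V" "K \<subseteq> V" "continuous_on V l" "\<And>w. w \<in> V \<Longrightarrow> exp (l w) = w"
proof (cases "K = {}")
  case True
  then show ?thesis using that[of "{}" "\<lambda>_. 0"] by auto
next
  case False
  then obtain x where x: "x \<in> K" by blast
  obtain R where R: "R > 0" "K \<subseteq> ball 0 R" using bounded_subset_ballD[OF compact_imp_bounded[OF K(1)]] by blast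
  define a where "a = complex_of_real R"
  have a: "a \<notin> ball 0 R" using R by (simp add: a_def)
  have "path_connected (- K)"
    using K by (intro connected_open_path_connected) (auto simp: open_Compl compact_imp_closed)
  then obtain g where g: "path g" "path_image g \<subseteq> - K" "pathstart g = 0" "pathfinish g = a"
    using K a R unfolding path_connected_def by (metis ComplI subsetD)
  define T where "T = path_image g \<union> - ball 0 R"
  have aT: "a \<in> path_image g \<inter> - ball 0 R" using g a by (auto simp: pathfinish_in_path_image)
  have "connected (- ball (0::complex) R)"
    by (intro connected_complement_bounded_convex) auto
  then have T: "connected T" unfolding T_def
    using aT by (intro connected_Un connected_path_image g) auto
  have clT: "closed T" unfolding T_def by (intro closed_Un closed_path_image g) auto
  have T0: "0 \<in> T" using g pathstart_in_path_image[of g] by (simp add: T_def)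
  have KT: "K \<subseteq> - T" using g R by (auto simp: T_def)
  define V where "V = connected_component_set (- T) x"
  have V: "V \<in> components (- T)" using x KT by (auto simp: V_def componentsI)
  have opV: "open V" using V clT open_components by blast
  have VT: "V \<subseteq> - T" using V in_components_subset by blast
  have bV: "bounded V" using VT by (intro bounded_subset[OF bounded_ball[of 0 R]]) (auto simp: T_def)
  have conV: "connected V" using V in_components_connected by blast
  \<comment> \<open>\<open>V\<close> is a component of the complement of a connected set. For a
    bounded connected open set, connectedness of the complement means simple connectedness.\<close>
  have "connected (- V)" using component_complement_connected[OF T V] .
  then have "simply_connected V"
    using simply_connected_iff_simple[OF opV bV] conV by blast
  moreover have "locally path_connected V" using opV by (rule open_imp_locally_path_connected)
  moreover have "w \<noteq> 0" if "w \<in> V" for w using that VT T0 by blast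
  ultimately obtain l where l: "continuous_on V l" "\<And>w. w \<in> V \<Longrightarrow> w = exp (l w)"
    using continuous_logarithm_on_simply_connected[OF continuous_on_id, of V] by blast
  have "K \<subseteq> V" unfolding V_def by (rule connected_component_maximal[OF x K(2) KT])
  then show ?thesis using that opV l by metis
qed

text \<open>\<open>\<Sigma>\<close> will be the union of the slits and \<open>h\<close> a logarithm
  of \<open>q\<close> around it. Filling in \<open>\<Sigma>\<close> by means of \<open>h\<close>
  produces a non-vanishing function on the whole disc, whose logarithm \<open>H\<close> is
  single-valued. On the level set of modulus \<open>1 / k\<close>, openness of \<open>q\<close> lets
  the argument increase further while compactness gives it a maximum.\<close>

lemma no_slit_log:
  fixes F :: "complex \<Rightarrow> complex"
  assumes C: "C = ball 0 1 - \<Sigma>" "compact \<Sigma>" "\<Sigma> \<noteq> {}" "\<Sigma> \<subseteq> ball 0 1" "connected C" "0 \<in> C"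
    and F: "F holomorphic_on C" "inj_on F C" "F ` C \<subseteq> ball 0 1" "F 0 = 0"
    and k: "0 < k" "k < 1"
    and N0: "open G" "\<Sigma> \<subseteq> G" "G \<subseteq> ball 0 1" "0 \<notin> G"
    and h: "continuous_on (G \<inter> C) h" "\<And>x. x \<in> G \<inter> C \<Longrightarrow> exp (h x) = F x / x"
    and big: "\<And>x. x \<in> G \<inter> C \<Longrightarrow> norm x < k * norm (F x)"
  shows False
proof -
  \<comment> \<open>The value at 0 removes the singularity, and it is non-zero because
    \<open>F\<close> is injective.\<close>
  define q where "q x = (if x = 0 then deriv F 0 else F x / x)" for x
  have opC: "open C" using C compact_imp_closed by auto
  have holq: "q holomorphic_on C"
  proof -
    have "(\<lambda>z. if z = 0 then deriv F 0 else (F z - F 0) / (z - 0)) holomorphic_on C"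
      by (rule pole_lemma_open[OF F(1) opC])
    moreover have "q = (\<lambda>z. if z = 0 then deriv F 0 else (F z - F 0) / (z - 0))"
      using F by (auto simp: q_def fun_eq_iff)
    ultimately show ?thesis by simp
  qed
  have contq: "continuous_on C q" using holq holomorphic_on_imp_continuous_on by blast
  have qnz: "q x \<noteq> 0" if "x \<in> C" for x
  proof (cases "x = 0")
    case True
    then show ?thesis
      using holomorphic_injective_imp_regular[OF F(1) opC F(2) C(6)] by (simp add: q_def)
  next
    case False
    then have "F x \<noteq> 0" using F that C by (metis inj_onD)
    then show ?thesis using False by (simp add: q_def)
  qed
  have qG: "norm (q x) > 1 / k" if "x \<in> G \<inter> C" for x
  proof -
    have "x \<noteq> 0" using that N0 by blast
    then show ?thesis using big[OF that] k by (simp add: q_def norm_divide field_simps)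
  qed
  \<comment> \<open>As \<open>norm (F x) < 1\<close>, a large quotient forces a small
    \<open>x\<close>; this keeps the level set away from the unit circle.\<close>
  have qk: "norm x < k" if "x \<in> C" "norm (q x) \<ge> 1 / k" for x
  proof (cases "x = 0")
    case False
    have "norm (F x) < 1" using F that by auto
    moreover have "norm x \<le> k * norm (F x)"
      using that False k by (simp add: q_def norm_divide field_simps)
    ultimately show ?thesis using k by (smt (verit) mult_less_cancel_left2)
  qed (use k in simp)
  \<comment> \<open>\<open>N\<close> is a smaller neighbourhood of \<open>\<Sigma>\<close> with
    closure in \<open>G\<close>, so its frontier lies where both \<open>h\<close> and
    \<open>q\<close> are available.\<close>
  obtain N Q where N: "open N" "open Q" "\<Sigma> \<subseteq> N" "- G \<subseteq> Q" "N \<inter> Q = {}"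
    using separation_normal_compact[of \<Sigma> "- G"] C N0 by (metis closed_Compl disjoint_eq_subset_Compl double_complement)
  have clN: "closure N \<subseteq> G"
    using N open_Int_closure_eq_empty[of Q N] by blast
  have frN: "frontier N \<subseteq> G \<inter> C" "frontier N \<inter> N = {}"
    using N clN C N0 frontier_disjoint_eq by (auto simp: frontier_def interior_open)
  \<comment> \<open>Tietze extends \<open>h\<close> from \<open>frontier N\<close> across
    \<open>N\<close>; there \<open>exp hh\<close> takes the place of \<open>q\<close> and cannot
    vanish.\<close>
  obtain hh where hh: "continuous_on UNIV hh" "\<And>x. x \<in> frontier N \<Longrightarrow> hh x = h x"
    using Tietze_unbounded[of "frontier N" h UNIV] continuous_on_subset[OF h(1) frN(1)] by auto
  define qh where "qh x = (if x \<in> closure N then exp (hh x) else q x)" for x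
  have ball: "closure N \<union> (ball 0 1 - N) = ball 0 1"
    using clN N0 closure_subset by blast
  have "continuous_on (closure N \<union> (ball 0 1 - N)) qh"
    unfolding qh_def
  proof (rule continuous_on_cases_local)
    show "closedin (top_of_set (closure N \<union> (ball 0 1 - N))) (closure N)"
      by (rule closed_subset) auto
    show "closedin (top_of_set (closure N \<union> (ball 0 1 - N))) (ball 0 1 - N)"
      unfolding ball using N by (auto simp: closedin_closed intro: exI[of _ "- N"])
    show "continuous_on (closure N) (\<lambda>x. exp (hh x))"
      by (intro continuous_intros continuous_on_subset[OF hh(1)]) auto
    show "continuous_on (ball 0 1 - N) q"
      by (rule continuous_on_subset[OF contq]) (use C N in auto)
    fix x assume "x \<in> closure N \<and> x \<notin> closure N \<or> x \<in> ball 0 1 - N \<and> x \<in> closure N"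
    then have x: "x \<in> frontier N" using N by (auto simp: frontier_def interior_open)
    then have "x \<in> G \<inter> C" "x \<noteq> 0" using frN N0 by auto
    then show "exp (hh x) = q x" using hh(2)[OF x] h(2) by (simp add: q_def)
  qed
  then have contqh: "continuous_on (ball 0 1) qh" using ball by simp
  have qhnz: "qh x \<noteq> 0" if "x \<in> ball 0 1" for x
  proof (cases "x \<in> closure N")
    case False
    then have "x \<in> C" using that C N closure_subset by blast
    then show ?thesis using qnz False by (simp add: qh_def)
  qed (simp add: qh_def)
  obtain H where H: "continuous_on (ball 0 1) H" "\<And>x. x \<in> ball 0 1 \<Longrightarrow> qh x = exp (H x)"
    using continuous_logarithm_on_ball[OF contqh qhnz] by blast
  define L where "L = {x \<in> C. norm (q x) = 1 / k}"
  have LG: "x \<notin> G" if "x \<in> L" for x using that qG by (force simp: L_def)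
  have "compact L"
  proof -
    \<comment> \<open>A compact part of \<open>C\<close> that holds the level set: \<open>L\<close>
      avoids \<open>G\<close>, hence \<open>N\<close>, and stays within radius
      \<open>k\<close>.\<close>
    define X where "X = cball (0::complex) k - N"
    have X: "compact X" "X \<subseteq> C" using N C k by (auto simp: X_def compact_diff)
    have "closed (X \<inter> (\<lambda>x. norm (q x)) -` {1 / k})"
      using X by (intro continuous_closed_preimage continuous_intros continuous_on_subset[OF contq] compact_imp_closed) auto
    then have "compact (X \<inter> (X \<inter> (\<lambda>x. norm (q x)) -` {1 / k}))" by (rule compact_Int_closed[OF X(1)])
    moreover have "L = X \<inter> (X \<inter> (\<lambda>x. norm (q x)) -` {1 / k})"
    proof (intro set_eqI iffI)
      fix x assume x: "x \<in> L"
      then have "norm x < k" "x \<notin> N" using qk LG clN closure_subset[of N] by (auto simp: L_def)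
      then show "x \<in> X \<inter> (X \<inter> (\<lambda>x. norm (q x)) -` {1 / k})" using x by (auto simp: X_def L_def)
    qed (use X in \<open>auto simp: L_def\<close>)
    ultimately show ?thesis by simp
  qed
  obtain u where u: "u \<in> G \<inter> C"
  proof -
    have "G \<inter> C \<noteq> {}"
    proof
      assume "G \<inter> C = {}"
      then have "\<Sigma> = G" using N0 C by blast
      then have "\<Sigma> = UNIV" using clopen[of \<Sigma>] N0 C compact_imp_closed by blast
      then show False using C(2) compact_imp_bounded not_bounded_UNIV by metis
    qed
    then show ?thesis using that by blast
  qed
  \<comment> \<open>A point on the positive real axis beyond \<open>k\<close> and beyond all of
    \<open>\<Sigma>\<close>.\<close>
  obtain v where v: "v \<in> C" "norm v > k"
  proof -
    obtain M where M: "M \<in> \<Sigma>" "\<And>x. x \<in> \<Sigma> \<Longrightarrow> norm x \<le> norm M"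
      using continuous_attains_sup[OF C(2,3) continuous_on_norm_id] by auto
    have "norm M < 1" using M(1) C(4) by auto
    then obtain t where t: "max k (norm M) < t" "t < 1"
      using dense[of "max k (norm M)" 1] k by (metis max_less_iff_conj)
    have "complex_of_real t \<notin> \<Sigma>" using M(2)[of "complex_of_real t"] t k by auto
    then have "complex_of_real t \<in> C" "norm (complex_of_real t) > k" using t C k by auto
    then show ?thesis using that by blast
  qed
  have qv: "norm (q v) < 1 / k" using qk[OF v(1)] v(2) by force
  have conn: "connected ((\<lambda>x. norm (q x)) ` C)"
    using C by (intro connected_continuous_image continuous_intros contq) auto
  \<comment> \<open>\<open>u\<close> and \<open>v\<close> lie on opposite sides of the level
    \<open>1 / k\<close>, and \<open>C\<close> is connected.\<close>
  have "1 / k \<in> (\<lambda>x. norm (q x)) ` C"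
    using connectedD_interval[OF conn, of "norm (q v)" "norm (q u)" "1 / k"] qv qG[OF u] v u by auto
  then have "L \<noteq> {}" by (auto simp: L_def)
  moreover have LB: "L \<subseteq> ball 0 1" using C by (auto simp: L_def)
  ultimately obtain p where p: "p \<in> L" "\<And>y. y \<in> L \<Longrightarrow> Im (H y) \<le> Im (H p)"
    using continuous_attains_sup[OF \<open>compact L\<close>, of "\<lambda>x. Im (H x)"] continuous_on_subset[OF H(1) LB] continuous_on_Im by blast
  define W where "W = C - closure N"
  have W: "open W" "W \<subseteq> C" "p \<in> W" using opC p clN LG by (auto simp: W_def L_def)
  have qW: "q x = exp (H x)" if "x \<in> W" for x
    using that H(2)[of x] C by (auto simp: W_def qh_def)
  have "continuous_on W H" using H(1) W C by (auto intro: continuous_on_subset)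
  then have "isCont H p" using W by (simp add: continuous_on_eq_continuous_at)
  then have "\<forall>\<^sub>F x in nhds p. dist (H x) (H p) < 1"
    unfolding isCont_def tendsto_at_iff_tendsto_nhds using tendstoD[of H "H p" "nhds p" 1] by simp
  moreover have "\<forall>\<^sub>F x in nhds p. x \<in> W" using W by (simp add: eventually_nhds_in_open)
  ultimately have "\<forall>\<^sub>F x in nhds p. dist (H x) (H p) < 1 \<and> x \<in> W" by (rule eventually_conj)
  \<comment> \<open>On \<open>S\<close> the logarithm moves by less than 1, which will rule out a
    jump by a multiple of \<open>2 * pi\<close>.\<close>
  then obtain S where S: "open S" "p \<in> S" "\<And>x. x \<in> S \<Longrightarrow> dist (H x) (H p) < 1 \<and> x \<in> W"
    unfolding eventually_nhds by blast
  have SC: "S \<subseteq> C" using S(3) W by blast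
  have "\<not> q constant_on C"
  proof
    assume "q constant_on C"
    then obtain c where "\<And>x. x \<in> C \<Longrightarrow> q x = c" by (auto simp: constant_on_def)
    then show False using qv qG[OF u] u v by auto
  qed
  then have "open (q ` S)" using open_mapping_thm[OF holq opC C(5) S(1) SC] by blast
  \<comment> \<open>Rotating \<open>q p\<close> by a small positive angle keeps its modulus and
    stays in the open image, so the point reached there is again in \<open>L\<close> but has a
    larger argument.\<close>
  moreover have "((\<lambda>t. q p * cis t) \<longlongrightarrow> q p * cis 0) (at_right 0)"
    by (intro tendsto_intros)
  ultimately have "\<forall>\<^sub>F t in at_right 0. q p * cis t \<in> q ` S"
    using S(2) by (intro topological_tendstoD) auto
  moreover have "\<forall>\<^sub>F t in at_right (0::real). t < 1" by (simp add: eventually_at_right_less eventually_at_right_field exI[of _ 1])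
  moreover have "\<forall>\<^sub>F t in at_right (0::real). 0 < t" by (simp add: eventually_at_right_less)
  ultimately have "\<forall>\<^sub>F t in at_right (0::real). q p * cis t \<in> q ` S \<and> t < 1 \<and> 0 < t"
    by (intro eventually_conj)
  then obtain t where t: "q p * cis t \<in> q ` S" "t < 1" "0 < t"
    using eventually_happens'[OF trivial_limit_at_right_real] by blast
  then obtain y where y: "y \<in> S" "q y = q p * cis t" by auto
  have "exp (H y) = exp (H p + \<i> * of_real t)"
    using y qW[of y] qW[of p] S(3)[of y] W by (simp add: exp_add cis_conv_exp)
  then obtain n :: int where n: "H y = H p + \<i> * of_real t + of_int (2 * n) * pi * \<i>"
    unfolding exp_eq by (auto simp: algebra_simps)
  have "n = 0"
  proof (rule ccontr)
    assume "n \<noteq> 0"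
    have "\<bar>Im (H y - H p)\<bar> < 1" using S(3)[OF y(1)] abs_Im_le_cmod[of "H y - H p"] by (simp add: dist_norm)
    moreover have "Im (H y - H p) = t + 2 * of_int n * pi" using n by (simp add: algebra_simps)
    ultimately have "\<bar>2 * of_int n * pi\<bar> < 2" using t by linarith
    moreover have "\<bar>real_of_int n\<bar> \<ge> 1" using \<open>n \<noteq> 0\<close> by linarith
    then have "\<bar>2 * of_int n * pi\<bar> \<ge> 2 * pi" by (simp add: abs_mult)
    ultimately show False using pi_gt3 by linarith
  qed
  then have "Im (H y) > Im (H p)" using n t by simp
  moreover have "y \<in> L" using y SC p by (auto simp: L_def norm_mult)
  ultimately show False using p(2) by force
qed

text \<open>Each local function is cut back to \<open>D s\<close>, the points of \<open>G s\<close>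
  strictly closer to \<open>s\<close> than to any other member of the family. These open sets are
  pairwise disjoint, so no compatibility between the local functions is required.\<close>

lemma glue_finite_compact:
  fixes \<S> :: "complex set set" and P :: "complex \<Rightarrow> bool" and f :: "complex \<Rightarrow> complex"
  assumes fin: "finite \<S>" and cpt: "\<And>s. s \<in> \<S> \<Longrightarrow> compact s \<and> s \<noteq> {}"
    and disj: "\<And>s t. s \<in> \<S> \<Longrightarrow> t \<in> \<S> \<Longrightarrow> s \<noteq> t \<Longrightarrow> s \<inter> t = {}"
    and C: "open C"
    and loc: "\<And>s. s \<in> \<S> \<Longrightarrow> \<exists>G h. open G \<and> s \<subseteq> G \<and> continuous_on (G \<inter> C) h \<and>
                 (\<forall>x\<in>G \<inter> C. exp (h x) = f x) \<and> (\<forall>x\<in>G. P x)"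
  obtains G h where "open G" "\<Union>\<S> \<subseteq> G" "continuous_on (G \<inter> C) h"
    "\<And>x. x \<in> G \<inter> C \<Longrightarrow> exp (h x) = f x" "\<And>x. x \<in> G \<Longrightarrow> P x"
proof -
  obtain G h where G: "\<And>s. s \<in> \<S> \<Longrightarrow> open (G s) \<and> s \<subseteq> G s \<and> continuous_on (G s \<inter> C) (h s) \<and>
                 (\<forall>x\<in>G s \<inter> C. exp (h s x) = f x) \<and> (\<forall>x\<in>G s. P x)"
    using loc by metis
  define D where "D s = G s \<inter> (\<Inter>t\<in>\<S> - {s}. {x. infdist x s < infdist x t})" for s
  have opD: "open (D s)" if "s \<in> \<S>" for s
    unfolding D_def using fin G that
    by (intro open_Int open_INT ballI open_Collect_less continuous_intros) auto
  have sD: "s \<subseteq> D s" if s: "s \<in> \<S>" for s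
  proof
    fix x assume x: "x \<in> s"
    have "infdist x s < infdist x t" if t: "t \<in> \<S>" "t \<noteq> s" for t
    proof -
      have "x \<notin> t" using disj s t x by blast
      then have "infdist x t > 0"
        using cpt[OF t(1)] infdist_nonneg[of x t] in_closed_iff_infdist_zero[of t x] compact_imp_closed
        by (metis order_less_le)
      then show ?thesis using x by simp
    qed
    then show "x \<in> D s" using G[OF s] x by (auto simp: D_def)
  qed
  have Ddisj: "s = t" if "s \<in> \<S>" "t \<in> \<S>" "x \<in> D s" "x \<in> D t" for s t x
  proof (rule ccontr)
    assume "s \<noteq> t"
    then have "infdist x s < infdist x t" "infdist x t < infdist x s" using that by (auto simp: D_def)
    then show False by simp
  qed
  define hh where "hh x = h (THE s. s \<in> \<S> \<and> x \<in> D s) x" for x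
  have hh: "hh x = h s x" if "s \<in> \<S>" "x \<in> D s" for s x
  proof -
    have "(THE s. s \<in> \<S> \<and> x \<in> D s) = s" using that Ddisj by (intro the_equality) auto
    then show ?thesis by (simp add: hh_def)
  qed
  show ?thesis
  proof (rule that[of "\<Union>s\<in>\<S>. D s" hh])
    show "open (\<Union>s\<in>\<S>. D s)" using opD by blast
    show "\<Union>\<S> \<subseteq> (\<Union>s\<in>\<S>. D s)" using sD by blast
    have "continuous_on (\<Union>s\<in>\<S>. D s \<inter> C) hh"
    proof (rule continuous_on_open_UN)
      fix s assume s: "s \<in> \<S>"
      show "open (D s \<inter> C)" using opD[OF s] C by blast
      have "continuous_on (D s \<inter> C) (h s)"
        using G[OF s] by (auto simp: D_def intro: continuous_on_subset)
      then show "continuous_on (D s \<inter> C) hh"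
        by (subst continuous_on_cong[OF refl, of _ hh "h s"]) (use hh[OF s] in auto)
    qed
    moreover have "(\<Union>s\<in>\<S>. D s \<inter> C) = (\<Union>s\<in>\<S>. D s) \<inter> C" by blast
    ultimately show "continuous_on ((\<Union>s\<in>\<S>. D s) \<inter> C) hh" by simp
    show "exp (hh x) = f x" if "x \<in> (\<Union>s\<in>\<S>. D s) \<inter> C" for x
      using that hh G by (auto simp: D_def)
    show "P x" if "x \<in> (\<Union>s\<in>\<S>. D s)" for x
      using that G by (auto simp: D_def)
  qed
qed

text \<open>The bound \<open>b < a + 2 * pi\<close> makes the circular path an arc, and an arc does
  not separate the plane.\<close>

lemma closed_proper_arcD:
  assumes "closed_proper_arc s"
  shows "compact s" "connected s" "connected (- s)" "0 \<notin> s" "s \<noteq> {}" "x \<in> s \<Longrightarrow> y \<in> s \<Longrightarrow> norm x = norm y"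
proof -
  obtain r a b where s: "0 < r" "a < b" "b < a + 2 * pi" "s = path_image (part_circlepath 0 r a b)"
    using assms unfolding closed_proper_arc_def by blast
  have "arc (part_circlepath 0 r a b)" using s by (intro arc_part_circlepath) auto
  then show "compact s" "connected s" "connected (- s)"
    using s connected_arc_complement[of "part_circlepath 0 r a b"]
    by (auto intro: compact_arc_image connected_arc_image)
  have "norm x = r" if "x \<in> s" for x
    using that s in_path_image_part_circlepath[of x 0 r a b] by simp
  then show "0 \<notin> s" "x \<in> s \<Longrightarrow> y \<in> s \<Longrightarrow> norm x = norm y" using s by force+
  show "s \<noteq> {}" using s by simp
qed

text \<open>In inverted coordinates 0 stands for infinity, so \<open>0 \<notin> K\<close> in
  \<open>ends\<close> says that no slit faces the outer boundary of the image. The slit and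
  \<open>K\<close> are then both compact, connected, non-separating and free of 0, which provides
  logarithms near each.\<close>

theorem slit_outside_inscribed_disc:
  fixes F :: "complex \<Rightarrow> complex"
  assumes C: "circularly_slit_disc C" "0 \<in> C" "finite (components (ball 0 1 - C))" "C \<noteq> ball 0 1"
    and F: "F holomorphic_on C" "inj_on F C" "F ` C \<subseteq> ball 0 1" "F 0 = 0"
    and r: "0 < r" "ball 0 r \<subseteq> F ` C"
    and ends: "\<And>s. s \<in> components (ball 0 1 - C) \<Longrightarrow>
        \<exists>K\<in>components (icompl 0 (F ` C)). 0 \<notin> K \<and> ends_to (invert_conj F 0) (icompl 0 C) (inverse ` s) K"
  shows "\<exists>x\<in>ball 0 1 - C. r \<le> norm x"
proof (rule ccontr)
  assume "\<not> ?thesis"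
  then have lt: "\<And>x. x \<in> ball 0 1 - C \<Longrightarrow> norm x < r" by force
  let ?S = "components (ball 0 1 - C)"
  define \<Sigma> where "\<Sigma> = ball 0 1 - C"
  have opC: "open C" and conC: "connected C" and Cb: "C \<subseteq> ball 0 1" and arc: "\<And>s. s \<in> ?S \<Longrightarrow> closed_proper_arc s"
    using C unfolding circularly_slit_disc_def plane_domain_def by auto
  have un: "\<Sigma> = \<Union>?S" by (simp add: \<Sigma>_def)
  have cpt: "compact \<Sigma>" unfolding un using C(3) arc closed_proper_arcD(1) by (intro compact_Union) auto
  have \<Sigma>: "\<Sigma> \<noteq> {}" "\<Sigma> \<subseteq> ball 0 1" "C = ball 0 1 - \<Sigma>" using C Cb by (auto simp: \<Sigma>_def)
  obtain M where M: "M \<in> \<Sigma>" "\<And>x. x \<in> \<Sigma> \<Longrightarrow> norm x \<le> norm M"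
    using continuous_attains_sup[OF cpt \<Sigma>(1) continuous_on_norm_id] by auto
  have "norm M < r" using lt M by (auto simp: \<Sigma>_def)
  \<comment> \<open>\<open>r'\<close> and \<open>k\<close> leave room on both sides: close to the
    slits \<open>norm x < k * r'\<close> and \<open>norm (F x) > r'\<close> will hold
    together.\<close>
  then obtain r' where r': "norm M < r'" "r' < r" using dense by blast
  have r'0: "r' > 0" using r' norm_ge_zero[of M] by linarith
  have "norm M / r' < 1" using r' r'0 by simp
  then obtain k where k: "norm M / r' < k" "k < 1" using dense by blast
  have k0: "k > 0" using k r'0 by (smt (verit) divide_nonneg_pos norm_ge_zero)
  have Mk: "norm M < k * r'" using k r'0 by (simp add: field_simps)
  have Fnz: "F x \<noteq> 0" if "x \<in> C" "x \<noteq> 0" for x using that F C by (metis inj_onD)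
  have opD: "open (F ` C)" using open_mapping_thm3[OF F(1) opC F(2)] .
  have D0: "0 \<in> F ` C" using C F by (metis image_eqI)
  have conD: "connected (F ` C)"
    using conC F holomorphic_on_imp_continuous_on connected_continuous_image by blast
  have cptD: "compact (icompl 0 (F ` C))" and con: "connected (- icompl 0 (F ` C))"
    using opD D0 conD by (auto intro: compact_icompl connected_Compl_icompl)
  \<comment> \<open>The image contains the disc of radius \<open>r\<close>, so inverted
    complementary points have modulus at most \<open>1 / r\<close>; the larger bound
    \<open>1 / r'\<close> holds on an open neighbourhood.\<close>
  have small: "norm w < 1 / r'" if "w \<in> icompl 0 (F ` C)" for w
  proof (cases "w = 0")
    case False
    then have "inverse w \<notin> ball 0 r" using that r by (auto simp: icompl_def)
    then have "r' < inverse (norm w)" using r'(2) by (simp add: norm_inverse)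
    then show ?thesis using r'0 False by (simp add: field_simps)
  qed (use r'0 in simp)
  \<comment> \<open>These pointwise conditions have to survive the gluing of the
    neighbourhoods.\<close>
  define P where "P x \<longleftrightarrow> x \<noteq> 0 \<and> x \<in> ball 0 1 \<and> (x \<in> C \<longrightarrow> norm x < k * norm (F x))" for x
  have loc: "\<exists>G h. open G \<and> s \<subseteq> G \<and> continuous_on (G \<inter> C) h \<and>
                 (\<forall>x\<in>G \<inter> C. exp (h x) = F x / x) \<and> (\<forall>x\<in>G. P x)" if s: "s \<in> ?S" for s
  proof -
    note sarc = closed_proper_arcD[OF arc[OF s]]
    have s\<Sigma>: "s \<subseteq> \<Sigma>" using s in_components_subset by (auto simp: \<Sigma>_def)
    obtain K where K: "K \<in> components (icompl 0 (F ` C))" "0 \<notin> K"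
      "ends_to (invert_conj F 0) (icompl 0 C) (inverse ` s) K" using ends[OF s] by blast
    have Kc: "compact K" "connected K" "connected (- K)"
      using compact_component[OF cptD K(1)] in_components_connected[OF K(1)]
        component_complement_connected[of "- icompl 0 (F ` C)" K] con K(1) by auto
    obtain V l where V: "open V" "K \<subseteq> V" "continuous_on V l" "\<And>w. w \<in> V \<Longrightarrow> exp (l w) = w"
      using continuous_log_near_compact[OF Kc K(2)] by metis
    obtain W m where W: "open W" "s \<subseteq> W" "continuous_on W m" "\<And>w. w \<in> W \<Longrightarrow> exp (m w) = w"
      using continuous_log_near_compact[OF sarc(1-4)] by metis
    have "open (V \<inter> ball 0 (1 / r'))" using V by blast
    moreover have "K \<subseteq> V \<inter> ball 0 (1 / r')" using V(2) small in_components_subset[OF K(1)] by auto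
    ultimately obtain V' where V': "open V'" "inverse ` s \<subseteq> V'"
      "invert_conj F 0 ` (V' - icompl 0 C) \<subseteq> V \<inter> ball 0 (1 / r')"
      by (rule ends_toE[OF K(3)])
    \<comment> \<open>The factors put \<open>inverse (F x)\<close> near \<open>K\<close>, make
      \<open>m\<close> available, and keep \<open>x\<close> in the unit disc and below the bound
      \<open>k * r'\<close>.\<close>
    define G where "G = (inverse -` V' \<inter> - {0}) \<inter> W \<inter> ball 0 1 \<inter> ball 0 (k * r')"
    have "open (inverse -` V' \<inter> - {0})"
      by (rule continuous_on_open_vimage[THEN iffD1, rule_format]) (auto intro!: continuous_intros V')
    then have G: "open G" using W by (auto simp: G_def)
    have sG: "s \<subseteq> G"
    proof
      fix x assume x: "x \<in> s"
      have "norm x \<le> norm M" using M(2) s\<Sigma> x by blast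
      then have "norm x < k * r'" using Mk by linarith
      then show "x \<in> G" using x V'(2) W(2) sarc(4) s\<Sigma> \<Sigma>(2) by (auto simp: G_def)
    qed
    have FG: "inverse (F x) \<in> V" "norm x < k * norm (F x)" "x \<noteq> 0" if x: "x \<in> G \<inter> C" for x
    proof -
      show x0: "x \<noteq> 0" using x by (auto simp: G_def)
      have "inverse x \<in> V' - icompl 0 C" using x x0 inverse_in_icompl[of x 0 C] by (auto simp: G_def)
      then have "invert_conj F 0 (inverse x) \<in> V \<inter> ball 0 (1 / r')" using V'(3) by blast
      then have *: "inverse (F x) \<in> V \<inter> ball 0 (1 / r')" by (simp add: invert_conj_def F(4))
      then show "inverse (F x) \<in> V" by blast
      have "inverse (norm (F x)) < 1 / r'" using * by (simp add: norm_inverse)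
      then have "r' < norm (F x)" using r'0 Fnz x x0 by (simp add: field_simps)
      then have "k * r' < k * norm (F x)" using k0 by simp
      moreover have "norm x < k * r'" using x by (simp add: G_def)
      ultimately show "norm x < k * norm (F x)" by linarith
    qed
    \<comment> \<open>A logarithm of \<open>F x\<close> minus one of \<open>x\<close>. The former is
      the negative of \<open>l\<close> at \<open>inverse (F x)\<close>, because \<open>l\<close>
      lives near \<open>K\<close> in inverted coordinates.\<close>
    define h where "h x = - l (inverse (F x)) - m x" for x
    have "continuous_on (G \<inter> C) h" unfolding h_def
    proof (intro continuous_on_diff continuous_on_minus)
      have "continuous_on (G \<inter> C) F"
        using F(1) holomorphic_on_imp_continuous_on continuous_on_subset by blast
      then have "continuous_on (G \<inter> C) (\<lambda>x. inverse (F x))"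
        using Fnz FG(3) by (intro continuous_on_inverse) auto
      then show "continuous_on (G \<inter> C) (\<lambda>x. l (inverse (F x)))"
        using FG(1) by (intro continuous_on_compose2[OF V(3)]) auto
      show "continuous_on (G \<inter> C) m" by (rule continuous_on_subset[OF W(3)]) (auto simp: G_def)
    qed
    moreover have "exp (h x) = F x / x" if x: "x \<in> G \<inter> C" for x
    proof -
      have "exp (m x) = x" using W(4) x by (auto simp: G_def)
      moreover have "exp (l (inverse (F x))) = inverse (F x)" using V(4) FG(1)[OF x] by blast
      ultimately show ?thesis by (simp add: h_def exp_diff exp_minus)
    qed
    moreover have "P x" if "x \<in> G" for x
      using that FG[of x] by (auto simp: P_def G_def)
    ultimately show ?thesis using G sG by blast
  qed
  have cpts: "compact s \<and> s \<noteq> {}" if "s \<in> ?S" for s using closed_proper_arcD[OF arc[OF that]] by blast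
  obtain G h where G: "open G" "\<Union>?S \<subseteq> G" "continuous_on (G \<inter> C) h"
    "\<And>x. x \<in> G \<inter> C \<Longrightarrow> exp (h x) = F x / x" "\<And>x. x \<in> G \<Longrightarrow> P x"
    by (rule glue_finite_compact[OF C(3) cpts disjoint_components opC loc]) blast+
  show False
    by (rule no_slit_log[OF \<Sigma>(3) cpt \<Sigma>(1,2) conC C(2) F k0 k(2) G(1), of h])
      (use G un in \<open>auto simp: P_def\<close>)
qed

subsection \<open>Slit maps and the squeezing function\<close>

lemma sphere_inv_boundary_component:
  assumes S: "open S" "p \<in> S" and G: "G \<in> boundary_components S"
  shows "Some p \<notin> G" "sphere_inv p ` G \<in> components (frontier (icompl p S))"
proof -
  have "G \<subseteq> riemann_sphere frontier_of (Some ` S)"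
    using G connected_components_of_subset by (fastforce simp: boundary_components_def sphere_components_def)
  then show "Some p \<notin> G" using sphere_inv_image_frontier(2)[OF S] by blast
  show "sphere_inv p ` G \<in> components (frontier (icompl p S))"
    using G sphere_components_sphere_inv[OF sphere_inv_image_frontier(2)[OF S]] sphere_inv_image_frontier(1)[OF S]
    unfolding boundary_components_def by auto
qed

lemma tends_to_boundary_component:
  assumes S: "open S" "connected S" "p \<in> S" and G: "G \<in> boundary_components S"
  shows "\<exists>K\<in>components (icompl p S). \<forall>s. range s \<subseteq> S \<longrightarrow> (tends_to_set s G \<longleftrightarrow> inv_tends p s K)"
proof -
  have A: "compact (icompl p S)" "connected (- icompl p S)"
    using S by (auto intro: compact_icompl connected_Compl_icompl)
  obtain K where K: "K \<in> components (icompl p S)" "sphere_inv p ` G = frontier K"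
    using components_frontier[OF A] sphere_inv_boundary_component(2)[OF S(1,3) G] by metis
  have "K \<subseteq> icompl p S" "closed K"
    using in_components_subset[OF K(1)] compact_component[OF A(1) K(1)] compact_imp_closed by auto
  then show ?thesis
    using K inv_tends_frontier tends_to_set_iff_inv_tends[OF sphere_inv_boundary_component(1)[OF S(1,3) G]] by metis
qed

text \<open>A frontier point of \<open>K\<close> lies in a component of the whole frontier, and that
  is the frontier of some complementary component; disjointness forces this one to be
  \<open>K\<close>.\<close>

lemma boundary_component_of_complement_component:
  assumes S: "open S" "connected S" "p \<in> S" and K: "K \<in> components (icompl p S)"
  obtains G where "G \<in> boundary_components S"
    "\<And>s. range s \<subseteq> S \<Longrightarrow> tends_to_set s G \<longleftrightarrow> inv_tends p s K"
proof -
  have A: "compact (icompl p S)" "connected (- icompl p S)"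
    using S by (auto intro: compact_icompl connected_Compl_icompl)
  have cl: "closed L" if "L \<in> components (icompl p S)" for L
    using compact_component[OF A(1) that] compact_imp_closed by blast
  obtain x where x: "x \<in> frontier K"
    using frontier_not_empty[of K] in_components_nonempty[OF K] compact_component[OF A(1) K]
      compact_imp_bounded not_bounded_UNIV by blast
  then have "x \<in> frontier (icompl p S)" using frontier_of_components_subset[OF K] by blast
  then obtain T where T: "T \<in> components (frontier (icompl p S))" "x \<in> T"
    using Union_components[of "frontier (icompl p S)"] by blast
  obtain K' where K': "K' \<in> components (icompl p S)" "T = frontier K'"
    using components_frontier[OF A T(1)] by metis
  have "x \<in> K \<inter> K'" using x T K' frontier_subset_closed cl K by blast
  then have "K' = K" using disjoint_components K K'(1) by blast
  have "T \<in> image (sphere_inv p) ` boundary_components S"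
    using T(1) sphere_components_sphere_inv[OF sphere_inv_image_frontier(2)[OF S(1,3)]] sphere_inv_image_frontier(1)[OF S(1,3)]
    unfolding boundary_components_def by simp
  then obtain G where G: "G \<in> boundary_components S" "sphere_inv p ` G = frontier K"
    using K' \<open>K' = K\<close> by auto
  have "tends_to_set s G \<longleftrightarrow> inv_tends p s K" if "range s \<subseteq> S" for s
    using G(2) inv_tends_frontier[OF that in_components_subset[OF K] cl[OF K]]
      tends_to_set_iff_inv_tends[OF sphere_inv_boundary_component(1)[OF S(1,3) G(1)]] by simp
  then show ?thesis using that G by blast
qed

text \<open>After inversion, distinct boundary components are disjoint compact sets, which have
  disjoint neighbourhoods.\<close>

lemma tends_to_boundary_component_unique:
  assumes S: "open S" "p \<in> S" and G: "G \<in> boundary_components S" "H \<in> boundary_components S"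
    and t: "tends_to_set s G" "tends_to_set s H"
  shows "G = H"
proof (rule ccontr)
  assume "G \<noteq> H"
  note G1 = sphere_inv_boundary_component[OF S G(1)] and H1 = sphere_inv_boundary_component[OF S G(2)]
  have cf: "compact (frontier (icompl p S))" using compact_frontier compact_icompl[OF S] by blast
  have "sphere_inv p ` G \<inter> sphere_inv p ` H \<noteq> {}"
    using inv_tends_disjoint tends_to_set_iff_inv_tends[OF G1(1)] tends_to_set_iff_inv_tends[OF H1(1)] t
      compact_component[OF cf] G1(2) H1(2) by metis
  then have "sphere_inv p ` G = sphere_inv p ` H" using disjoint_components[OF G1(2) H1(2)] by blast
  then have "G = H" using inj_on_image_eq_iff[OF inj_on_sphere_inv[of p]] G1(1) H1(1) by blast
  then show False using \<open>G \<noteq> H\<close> by blast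
qed

section \<open>Slits as complementary components\<close>

lemma tends_to_set_Some_image:
  assumes "0 \<notin> s" shows "tends_to_set t (Some ` s) \<longleftrightarrow> inv_tends 0 t (inverse ` s)"
proof -
  have "sphere_inv 0 ` Some ` s = inverse ` s" by (simp add: image_image)
  then show ?thesis using tends_to_set_iff_inv_tends[of 0 "Some ` s" t] assms by auto
qed

lemma compact_inverse_image:
  assumes "compact s" "(0::complex) \<notin> s" shows "compact (inverse ` s)"
  using assms by (intro compact_continuous_image continuous_on_inverse continuous_on_id) auto

text \<open>The complement of \<open>C\<close> in the sphere also contains the exterior of the disc,
  which must not join up with the slit. Sura-Bura encloses \<open>s\<close> in a relatively clopen
  compact set \<open>K\<close> inside the disc, and the component \<open>T\<close> of the whole
  complement is trapped in its inverse.\<close>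

lemma inverse_component:
  assumes C: "C \<subseteq> ball 0 1" "open C" "0 \<in> C" and s: "s \<in> components (ball 0 1 - C)" "compact s"
  shows "inverse ` s \<in> components (icompl 0 C)"
proof -
  have sub: "s \<subseteq> ball 0 1 - C" using s in_components_subset by blast
  have s0: "0 \<notin> s" using sub C by blast
  have conn: "connected (inverse ` s)"
    using in_components_connected[OF s(1)] s0 by (intro connected_continuous_image continuous_on_inverse continuous_on_id) auto
  have subI: "inverse ` s \<subseteq> icompl 0 C" using sub by (auto simp: icompl_def)
  obtain x where x: "x \<in> s" using in_components_nonempty[OF s(1)] by blast
  define T where "T = connected_component_set (icompl 0 C) (inverse x)"
  have T: "T \<in> components (icompl 0 C)" using x subI by (auto simp: T_def componentsI)
  have sT: "inverse ` s \<subseteq> T" unfolding T_def using conn subI x by (intro connected_component_maximal) auto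
  have "locally compact (ball 0 1 - C)"
    using C by (intro locally_compact_Int[of "ball 0 1" "- C", folded Diff_eq])
      (auto intro: open_imp_locally_compact closed_imp_locally_compact)
  then obtain K where K: "openin (top_of_set (ball 0 1 - C)) K" "compact K" "s \<subseteq> K"
    using Sura_Bura_clopen_subset[OF _ s(1,2) open_ball[of 0 1]] sub by (metis Diff_subset subset_trans)
  have KC: "K \<subseteq> ball 0 1 - C" using K(1) openin_imp_subset by blast
  have K0: "0 \<notin> K" using KC C by blast
  obtain Q where Q: "open Q" "K = (ball 0 1 - C) \<inter> Q" using K(1) by (auto simp: openin_open)
  define Q' where "Q' = inverse -` (Q \<inter> ball 0 1) \<inter> - {0::complex}"
  have "open Q'" unfolding Q'_def
    by (rule continuous_on_open_vimage[THEN iffD1, rule_format]) (auto intro!: continuous_intros Q)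
  \<comment> \<open>\<open>K\<close> sits in the open disc, so its inverse is relatively open in the
    full complement; it is also closed, by compactness.\<close>
  moreover have IK: "inverse ` K = icompl 0 C \<inter> Q'"
  proof (intro set_eqI iffI)
    fix w assume "w \<in> inverse ` K"
    then obtain y where "y \<in> K" "w = inverse y" by blast
    then show "w \<in> icompl 0 C \<inter> Q'" using KC K0 Q by (auto simp: icompl_def Q'_def)
  next
    fix w assume w: "w \<in> icompl 0 C \<inter> Q'"
    then have "inverse w \<in> K" using Q by (auto simp: icompl_def Q'_def)
    then show "w \<in> inverse ` K" by (intro image_eqI[of _ _ "inverse w"]) auto
  qed
  ultimately have "openin (top_of_set T) (T \<inter> inverse ` K)"
    using in_components_subset[OF T] by (auto simp: openin_open)
  moreover have "closedin (top_of_set T) (T \<inter> inverse ` K)"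
    using compact_imp_closed[OF compact_inverse_image[OF K(2) K0]] by (rule closedin_closed_Int)
  moreover have "T \<inter> inverse ` K \<noteq> {}" using x sT K by blast
  ultimately have "T \<inter> inverse ` K = T"
    using in_components_connected[OF T] unfolding connected_clopen by blast
  then have TK: "T \<subseteq> inverse ` K" by blast
  then have T0: "0 \<notin> T" using K0 by auto
  have conT: "connected (inverse ` T)"
    using in_components_connected[OF T] T0 by (intro connected_continuous_image continuous_on_inverse continuous_on_id) auto
  have "inverse ` T \<subseteq> K" using TK by force
  then have subT: "inverse ` T \<subseteq> ball 0 1 - C" using KC by blast
  have "s \<subseteq> inverse ` T" using sT by force
  have "inverse ` T \<subseteq> s"
    by (rule components_maximal[OF s(1) conT subT]) (use \<open>s \<subseteq> inverse ` T\<close> x in blast)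
  then have "inverse ` T = s" using \<open>s \<subseteq> inverse ` T\<close> by (rule subset_antisym)
  then have "T = inverse ` s" by force
  then show ?thesis using T by simp
qed

lemma slit_mapD:
  assumes "slit_map S z G \<psi>" "open S" "z \<in> S"
  shows "circularly_slit_disc (\<psi> ` S)" "homeomorphism S (\<psi> ` S) \<psi> (inv_into S \<psi>)"
    "\<psi> holomorphic_on S" "inj_on \<psi> S" "inv_into S \<psi> holomorphic_on \<psi> ` S"
    "open (\<psi> ` S)" "\<psi> ` S \<subseteq> ball 0 1" "\<psi> z = 0" "0 \<in> \<psi> ` S"
    "s \<in> components (ball 0 1 - \<psi> ` S) \<Longrightarrow> closed_proper_arc s"
    "boundary_corresponds \<psi> S G (Some ` sphere 0 1)"
proof -
  show 1: "circularly_slit_disc (\<psi> ` S)" "\<psi> holomorphic_on S" "inj_on \<psi> S"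
    "inv_into S \<psi> holomorphic_on \<psi> ` S" "\<psi> z = 0" "boundary_corresponds \<psi> S G (Some ` sphere 0 1)"
    using assms unfolding slit_map_def biholomorphism_def bij_betw_def by auto
  show "open (\<psi> ` S)" "\<psi> ` S \<subseteq> ball 0 1" "s \<in> components (ball 0 1 - \<psi> ` S) \<Longrightarrow> closed_proper_arc s"
    using 1 unfolding circularly_slit_disc_def plane_domain_def by auto
  show "0 \<in> \<psi> ` S" using 1 assms(3) by (metis image_eqI)
  show "homeomorphism S (\<psi> ` S) \<psi> (inv_into S \<psi>)"
    unfolding homeomorphism_def using 1 holomorphic_on_imp_continuous_on
    by (auto simp: inv_into_image_cancel f_inv_into_f)
qed

lemma slit_norm:
  assumes "closed_proper_arc s" "x \<in> s" shows "infdist 0 s = norm x"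
proof -
  have "infdist 0 s = (INF y\<in>s. norm y)" using assms by (auto simp: infdist_def)
  also have "\<dots> = (INF y\<in>s. norm x)" using closed_proper_arcD(6)[OF assms(1) assms(2)] by (intro INF_cong) auto
  also have "\<dots> = norm x" using closed_proper_arcD(5)[OF assms(1)] by simp
  finally show ?thesis .
qed

text \<open>Inversion embeds the slits into the complementary components of the image, and these are
  finite in number because \<open>\<psi>\<close> is a homeomorphism.\<close>

lemma finite_slits:
  assumes S: "open S" "connected S" "z \<in> S" "finite (components (icompl z S))"
    and \<psi>: "slit_map S z G \<psi>"
  shows "finite (components (icompl 0 (\<psi> ` S)))" "finite (components (ball 0 1 - \<psi> ` S))"
proof -
  note \<psi>D = slit_mapD[OF \<psi> S(1,3)]
  show fin: "finite (components (icompl 0 (\<psi> ` S)))"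
    using end_correspondence(1)[OF S(1-3) \<psi>D(6,2) S(4)] \<psi>D(8) by simp
  have "(\<lambda>s. inverse ` s) ` components (ball 0 1 - \<psi> ` S) \<subseteq> components (icompl 0 (\<psi> ` S))"
    using inverse_component[OF \<psi>D(7,6,9)] closed_proper_arcD(1)[OF \<psi>D(10)] by blast
  moreover have "inj_on (\<lambda>s. inverse ` s) (components (ball 0 1 - \<psi> ` S))"
    by (intro inj_onI) (metis (no_types, lifting) inj_image_eq_iff inj_onI inverse_eq_iff_eq)
  ultimately show "finite (components (ball 0 1 - \<psi> ` S))"
    using fin finite_imageD finite_subset by metis
qed

text \<open>Both bounds start from a slit and need a boundary component for it. As
  \<open>slit\<close> is a definite description, uniqueness is part of the task: the images of one
  sequence tending to \<open>H\<close> tend to every set that corresponds to \<open>H\<close>, while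
  distinct slits are disjoint.\<close>

lemma slit_boundary_component:
  assumes S: "open S" "connected S" "z \<in> S" "finite (components (icompl z S))"
    and \<psi>: "slit_map S z G \<psi>" and s: "s \<in> components (ball 0 1 - \<psi> ` S)"
  obtains H where "H \<in> boundary_components S" "H \<noteq> G" "slit S \<psi> H = s"
proof -
  note \<psi>D = slit_mapD[OF \<psi> S(1,3)]
  have arcs: "compact t" "0 \<notin> t" if "t \<in> components (ball 0 1 - \<psi> ` S)" for t
    using closed_proper_arcD[OF \<psi>D(10)[OF that]] by auto
  have "inverse ` s \<in> components (icompl (\<psi> z) (\<psi> ` S))"
    using inverse_component[OF \<psi>D(7,6,9) s arcs(1)[OF s]] \<psi>D(8) by simp
  then obtain K where K: "K \<in> components (icompl z S)"
    "\<And>t. range t \<subseteq> S \<Longrightarrow> inv_tends z t K \<longleftrightarrow> inv_tends 0 (\<psi> \<circ> t) (inverse ` s)"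
    using end_correspondence(2)[OF S(1-3) \<psi>D(6,2) S(4)] \<psi>D(8) by metis
  obtain H where H: "H \<in> boundary_components S"
    "\<And>t. range t \<subseteq> S \<Longrightarrow> tends_to_set t H \<longleftrightarrow> inv_tends z t K"
    using boundary_component_of_complement_component[OF S(1-3) K(1)] by metis
  obtain t where t: "range t \<subseteq> S" "inv_tends z t K" using inv_tends_exists[OF S(1,3) K(1)] by metis
  have meet: "s \<inter> s' \<noteq> {}" if s': "compact s'" "0 \<notin> s'" "boundary_corresponds \<psi> S H (Some ` s')" for s'
  proof -
    have "inv_tends 0 (\<psi> \<circ> t) (inverse ` s')"
      using s' t H tends_to_set_Some_image[OF s'(2)] unfolding boundary_corresponds_def by blast
    moreover have "inv_tends 0 (\<psi> \<circ> t) (inverse ` s)" using K t by blast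
    ultimately have "inverse ` s \<inter> inverse ` s' \<noteq> {}"
      using inv_tends_disjoint compact_inverse_image s' arcs[OF s] by metis
    then show ?thesis by (auto simp: image_def)
  qed
  have corr: "boundary_corresponds \<psi> S H (Some ` s)"
    unfolding boundary_corresponds_def using H K tends_to_set_Some_image[OF arcs(2)[OF s]] by auto
  have "H \<noteq> G"
  proof
    assume "H = G"
    then have "s \<inter> sphere 0 1 \<noteq> {}" using meet[of "sphere 0 1"] \<psi>D(11) by auto
    then show False using in_components_subset[OF s] by auto
  qed
  moreover have "slit S \<psi> H = s"
    unfolding slit_def
  proof (rule the_equality)
    show "s' = s" if "s' \<in> components (ball 0 1 - \<psi> ` S) \<and> boundary_corresponds \<psi> S H (Some ` s')" for s'
      using that meet[of s'] arcs[of s'] disjoint_components[OF s, of s'] by blast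
  qed (use s corr in auto)
  ultimately show ?thesis using that H by blast
qed

text \<open>If the image were the whole disc, a sequence tending to \<open>H\<close> would have
  images tending to the unit circle, so it would tend to \<open>G\<close> as well.\<close>

lemma slit_map_not_onto_disc:
  assumes S: "open S" "connected S" "z \<in> S" "finite (components (icompl z S))"
    and \<psi>: "slit_map S z G \<psi>" and G: "G \<in> boundary_components S" "H \<in> boundary_components S" "G \<noteq> H"
  shows "\<psi> ` S \<noteq> ball 0 1"
proof
  assume eq: "\<psi> ` S = ball 0 1"
  note \<psi>D = slit_mapD[OF \<psi> S(1,3)]
  obtain K where K: "K \<in> components (icompl z S)"
    "\<And>t. range t \<subseteq> S \<Longrightarrow> tends_to_set t H \<longleftrightarrow> inv_tends z t K"
    using tends_to_boundary_component[OF S(1-3) G(2)] by metis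
  obtain L where L: "L \<in> components (icompl 0 (ball 0 1))"
    "\<And>t. range t \<subseteq> S \<Longrightarrow> inv_tends z t K \<longleftrightarrow> inv_tends 0 (\<psi> \<circ> t) L"
    using end_correspondence(3)[OF S(1-3) \<psi>D(6,2) S(4) K(1)] \<psi>D(8) eq by metis
  obtain t where t: "range t \<subseteq> S" "inv_tends z t K" using inv_tends_exists[OF S(1,3) K(1)] by metis
  have disc: "icompl 0 (ball 0 1) = cball 0 1"
  proof (rule set_eqI)
    fix x :: complex
    show "x \<in> icompl 0 (ball 0 1) \<longleftrightarrow> x \<in> cball 0 1"
    proof (cases "x = 0")
      case False
      then have "inverse (norm x) < 1 \<longleftrightarrow> 1 < norm x" by (simp add: field_simps)
      then show ?thesis using False by (auto simp: icompl_def norm_inverse)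
    qed simp
  qed
  have "inv_tends 0 (\<psi> \<circ> t) L" using L t by blast
  then have "inv_tends 0 (\<psi> \<circ> t) (cball 0 1)"
    using in_components_subset[OF L(1)] unfolding disc inv_tends_def by (meson subset_trans)
  then have "inv_tends 0 (\<psi> \<circ> t) (sphere 0 1)"
    using inv_tends_frontier[of "\<psi> \<circ> t" "ball 0 1" "cball 0 1" 0] t eq disc by auto
  moreover have "inverse ` sphere 0 1 = sphere (0::complex) 1"
  proof -
    have "x \<in> inverse ` sphere 0 1" if "x \<in> sphere 0 1" for x :: complex
      using that by (intro image_eqI[of _ _ "inverse x"]) (auto simp: norm_inverse)
    then show ?thesis by (auto simp: norm_inverse)
  qed
  ultimately have "tends_to_set (\<psi> \<circ> t) (Some ` sphere 0 1)"
    using tends_to_set_Some_image[of "sphere 0 1"] by simp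
  then have "tends_to_set t G" using \<psi>D(11) t unfolding boundary_corresponds_def by blast
  moreover have "tends_to_set t H" using K t by blast
  ultimately show False using tends_to_boundary_component_unique[OF S(1,3) G(1,2)] G(3) by blast
qed

lemma slit_map_slit_exists:
  assumes "open S" "z \<in> S" "slit_map S z G \<psi>" "\<psi> ` S \<noteq> ball 0 1"
  shows "components (ball 0 1 - \<psi> ` S) \<noteq> {}"
  using slit_mapD(7)[OF assms(3,1,2)] assms(4) by (auto simp: components_eq_empty)

section \<open>The two bounds for the squeezing function\<close>

lemma bdd_above_squeezing:
  "bdd_above {r. 0 < r \<and> r \<le> 1 \<and> (\<exists>f\<in>univalent_maps S. f z = 0 \<and> ball 0 r \<subseteq> f ` S)}"
  by (rule bdd_aboveI[of _ 1]) auto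

text \<open>Among the finitely many slits, the one nearest to 0 gives an admissible radius: no point
  of smaller modulus is missing from the image.\<close>

lemma slit_map_squeezing:
  assumes S: "open S" "connected S" "z \<in> S" "finite (components (icompl z S))"
    and \<psi>: "slit_map S z G \<psi>" "\<psi> ` S \<noteq> ball 0 1"
  obtains s where "s \<in> components (ball 0 1 - \<psi> ` S)"
    "infdist 0 s \<in> {r. 0 < r \<and> r \<le> 1 \<and> (\<exists>f\<in>univalent_maps S. f z = 0 \<and> ball 0 r \<subseteq> f ` S)}"
proof -
  let ?A = "components (ball 0 1 - \<psi> ` S)"
  note \<psi>D = slit_mapD[OF \<psi>(1) S(1,3)]
  have fin: "finite ?A" "?A \<noteq> {}" using finite_slits(2)[OF S \<psi>(1)] slit_map_slit_exists[OF S(1,3) \<psi>] by auto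
  then obtain s where s: "s \<in> ?A" "\<And>t. t \<in> ?A \<Longrightarrow> infdist 0 s \<le> infdist 0 t"
    using ex_is_arg_min_if_finite[OF fin, of "infdist 0"] by (auto simp: is_arg_min_linorder)
  obtain x where x: "x \<in> s" using in_components_nonempty[OF s(1)] by blast
  have nx: "infdist 0 s = norm x" using slit_norm[OF \<psi>D(10)[OF s(1)] x] .
  have "x \<in> ball 0 1 - \<psi> ` S" using in_components_subset[OF s(1)] x by blast
  then have "0 < norm x" "norm x \<le> 1" using \<psi>D(9) by (auto simp: less_imp_le)
  moreover have "\<psi> \<in> univalent_maps S" using \<psi>D by (auto simp: univalent_maps_def)
  moreover have "ball 0 (norm x) \<subseteq> \<psi> ` S"
  proof
    fix y :: complex assume y: "y \<in> ball 0 (norm x)"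
    show "y \<in> \<psi> ` S"
    proof (rule ccontr)
      assume "y \<notin> \<psi> ` S"
      then have "y \<in> ball 0 1 - \<psi> ` S" using y \<open>norm x \<le> 1\<close> by auto
      then obtain t where t: "t \<in> ?A" "y \<in> t" using Union_components[of "ball 0 1 - \<psi> ` S"] by blast
      then show False using s(2)[OF t(1)] slit_norm[OF \<psi>D(10)[OF t(1)] t(2)] nx y by auto
    qed
  qed
  ultimately show ?thesis using that[OF s(1)] nx \<psi>D(8) by auto
qed

text \<open>\<open>G\<close> is the boundary component that \<open>f\<close> sends to the outer
  boundary of its image; it depends on \<open>f\<close> alone and therefore serves for every slit
  map normalised at \<open>G\<close>.\<close>

lemma univalent_map_slit_radius:
  assumes S: "open S" "connected S" "z \<in> S" "finite (components (icompl z S))"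
    and f: "f \<in> univalent_maps S" "f z = 0" and r: "0 < r" "ball 0 r \<subseteq> f ` S"
  obtains G where "G \<in> boundary_components S"
    "\<And>\<psi>. slit_map S z G \<psi> \<Longrightarrow> \<psi> ` S \<noteq> ball 0 1 \<Longrightarrow> \<exists>x\<in>ball 0 1 - \<psi> ` S. r \<le> norm x"
proof -
  have f': "f holomorphic_on S" "inj_on f S" "f ` S \<subseteq> ball 0 1" using f by (auto simp: univalent_maps_def)
  obtain g where g: "homeomorphism S (f ` S) f g"
    using invariance_of_domain_homeomorphism[OF S(1) holomorphic_on_imp_continuous_on[OF f'(1)] _ f'(2)] by blast
  have opD: "open (f ` S)" using open_mapping_thm3[OF f'(1) S(1) f'(2)] .
  \<comment> \<open>0 is the inverted point at infinity, so \<open>L0\<close> is the outer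
    complementary component of the image of \<open>f\<close>.\<close>
  define L0 where "L0 = connected_component_set (icompl 0 (f ` S)) 0"
  have L0: "L0 \<in> components (icompl 0 (f ` S))" "0 \<in> L0"
    by (auto simp: L0_def componentsI)
  then obtain K where K: "K \<in> components (icompl z S)"
    "\<And>t. range t \<subseteq> S \<Longrightarrow> inv_tends z t K \<longleftrightarrow> inv_tends 0 (f \<circ> t) L0"
    using end_correspondence(2)[OF S(1-3) opD g S(4)] f(2) by metis
  obtain G where G: "G \<in> boundary_components S"
    "\<And>t. range t \<subseteq> S \<Longrightarrow> tends_to_set t G \<longleftrightarrow> inv_tends z t K"
    using boundary_component_of_complement_component[OF S(1-3) K(1)] by metis
  have "\<exists>x\<in>ball 0 1 - \<psi> ` S. r \<le> norm x" if \<psi>: "slit_map S z G \<psi>" "\<psi> ` S \<noteq> ball 0 1" for \<psi>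
  proof -
    note \<psi>D = slit_mapD[OF \<psi>(1) S(1,3)]
    define C where "C = \<psi> ` S"
    define F where "F = f \<circ> inv_into S \<psi>"
    have inv: "inv_into S \<psi> ` C = S" "\<And>x. x \<in> C \<Longrightarrow> \<psi> (inv_into S \<psi> x) = x" "inv_into S \<psi> 0 = z"
      using \<psi>D(2,4,8) S(3) by (auto simp: C_def homeomorphism_def f_inv_into_f intro: inv_into_f_eq)
    have F: "F holomorphic_on C" "F 0 = 0"
      using holomorphic_on_compose[of "inv_into S \<psi>" C f] \<psi>D(5) f' f(2) inv
      by (auto simp: F_def C_def)
    have FC: "F ` C = f ` S" using inv(1) by (metis F_def image_comp)
    have Finj: "inj_on F C"
      unfolding F_def using inv(1) f'(2) by (intro comp_inj_on) (auto simp: C_def inj_on_inv_into)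
    have homF: "homeomorphism C (f ` S) F (\<psi> \<circ> g)"
      unfolding F_def using homeomorphism_compose[OF homeomorphism_symD[OF \<psi>D(2)] g] by (simp add: C_def)
    have conC: "connected C" using \<psi>D(1) by (auto simp: C_def circularly_slit_disc_def plane_domain_def)
    have finC: "finite (components (icompl 0 C))" "finite (components (ball 0 1 - C))"
      using finite_slits[OF S \<psi>(1)] by (auto simp: C_def)
    have opC: "open C" and C0: "0 \<in> C" using \<psi>D by (auto simp: C_def)
    have "\<exists>x\<in>ball 0 1 - C. r \<le> norm x"
    proof (rule slit_outside_inscribed_disc)
      show "circularly_slit_disc C" "C \<noteq> ball 0 1" "F ` C \<subseteq> ball 0 1" "ball 0 r \<subseteq> F ` C"
        using \<psi>D \<psi> FC f' r by (auto simp: C_def)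
      fix s assume s: "s \<in> components (ball 0 1 - C)"
      note arc = closed_proper_arcD[OF \<psi>D(10)[OF s[unfolded C_def]]]
      have comp: "inverse ` s \<in> components (icompl 0 C)"
        using inverse_component[of C s] s arc(1) \<psi>D by (auto simp: C_def)
      obtain K' where K': "K' \<in> components (icompl 0 (f ` S))" "ends_to (invert_conj F 0) (icompl 0 C) (inverse ` s) K'"
        "\<And>t. range t \<subseteq> C \<Longrightarrow> inv_tends 0 t (inverse ` s) \<longleftrightarrow> inv_tends 0 (F \<circ> t) K'"
        using end_correspondence(3)[OF opC conC C0 opD homF finC(1) comp] F(2) by metis
      \<comment> \<open>Otherwise a sequence tending to \<open>s\<close> would have images under
        \<open>F\<close> tending to \<open>L0\<close>. Pulled back to \<open>S\<close> it would tend
        to \<open>G\<close>, so the sequence itself would tend to the unit circle, which is disjoint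
        from \<open>s\<close>.\<close>
      have "0 \<notin> K'"
      proof
        assume "0 \<in> K'"
        then have eq: "K' = L0" using disjoint_components[OF K'(1) L0(1)] L0(2) by blast
        obtain t where t: "range t \<subseteq> C" "inv_tends 0 t (inverse ` s)"
          using inv_tends_exists[OF opC C0 comp] by metis
        define u where "u = inv_into S \<psi> \<circ> t"
        have u: "range u \<subseteq> S" using t inv(1) by (auto simp: u_def)
        have "\<psi> \<circ> u = t" using t(1) inv(2) by (auto simp: u_def fun_eq_iff)
        moreover have "f \<circ> u = F \<circ> t" by (simp add: u_def F_def comp_assoc)
        ultimately have "tends_to_set t (Some ` sphere 0 1)"
          using G(2)[OF u] K(2)[OF u] K'(3)[OF t(1)] t(2) eq \<psi>D(11) u unfolding boundary_corresponds_def by metis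
        then have "inv_tends 0 t (inverse ` sphere 0 1)" using tends_to_set_Some_image[of "sphere 0 1"] by simp
        then have "inverse ` s \<inter> inverse ` sphere 0 1 \<noteq> {}"
          using inv_tends_disjoint[OF t(2)] compact_inverse_image[OF arc(1,4)] compact_inverse_image[of "sphere 0 1"] by simp
        then have "s \<inter> sphere 0 1 \<noteq> {}" by (auto simp: image_def)
        then show False using in_components_subset[OF s] by auto
      qed
      then show "\<exists>K\<in>components (icompl 0 (F ` C)). 0 \<notin> K \<and> ends_to (invert_conj F 0) (icompl 0 C) (inverse ` s) K"
        using K' FC by auto
    qed (use F Finj finC C0 r in auto)
    then show ?thesis by (simp add: C_def)
  qed
  then show ?thesis using that G by blast
qed

text \<open>What remains is to pass from slits and boundary components to indices through
  \<open>\<Gamma>\<close>, and from single radii to the supremum and the finite extrema.\<close>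

theorem theorem2p2:
  fixes n :: nat
    and \<Omega> :: "complex set"
    and \<Gamma> :: "nat \<Rightarrow> complex option set"
    and z :: complex
    and \<psi> :: "nat \<Rightarrow> complex \<Rightarrow> complex"
  assumes "n \<ge> 2"
    and "n_connected n \<Omega>"
    and "nondegenerate_boundary \<Omega>"
    and "bij_betw \<Gamma> {1..n} (boundary_components \<Omega>)"
    and "z \<in> \<Omega>"
    and "\<And>j. j \<in> {1..n} \<Longrightarrow> slit_map \<Omega> z (\<Gamma> j) (\<psi> j)"
  shows "(MAX j\<in>{1..n}. MIN i\<in>{1..n} - {j}. slit_radius \<Omega> (\<psi> j) (\<Gamma> i)) \<le> squeezing \<Omega> z \<and>
         squeezing \<Omega> z \<le> (MAX j\<in>{1..n}. MAX i\<in>{1..n} - {j}. slit_radius \<Omega> (\<psi> j) (\<Gamma> i))"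
proof -
  let ?R = "{r. 0 < r \<and> r \<le> 1 \<and> (\<exists>f\<in>univalent_maps \<Omega>. f z = 0 \<and> ball 0 r \<subseteq> f ` \<Omega>)}"
  let ?rad = "\<lambda>j i. slit_radius \<Omega> (\<psi> j) (\<Gamma> i)"
  have op: "open \<Omega>" and con: "connected \<Omega>" and fin: "finite (complement_components \<Omega>)"
    using assms(2) by (auto simp: n_connected_def plane_domain_def)
  have "Some z \<notin> topspace riemann_sphere - Some ` \<Omega>" using assms(5) by simp
  from sphere_components_sphere_inv[OF this] have "finite (components (icompl z \<Omega>))"
    using fin sphere_inv_image_complement[OF assms(5)] by (simp add: complement_components_def)
  note S = op con assms(5) this
  have surj: "\<exists>i\<in>{1..n}. G = \<Gamma> i" if "G \<in> boundary_components \<Omega>" for G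
    using that assms(4) by (auto simp: bij_betw_def)
  have \<Gamma>: "\<Gamma> i \<in> boundary_components \<Omega>" if "i \<in> {1..n}" for i
    using that assms(4) by (auto simp: bij_betw_def)
  have not_disc: "\<psi> j ` \<Omega> \<noteq> ball 0 1" if j: "j \<in> {1..n}" for j
  proof -
    \<comment> \<open>An index other than \<open>j\<close>, available because
      \<open>n \<ge> 2\<close>.\<close>
    define i :: nat where "i = (if j = 1 then 2 else 1)"
    have i: "i \<in> {1..n}" "i \<noteq> j" using assms(1) by (auto simp: i_def)
    then have "\<Gamma> j \<noteq> \<Gamma> i" using inj_onD[OF bij_betw_imp_inj_on[OF assms(4)]] j by metis
    then show ?thesis using slit_map_not_onto_disc[OF S assms(6)[OF j] \<Gamma>[OF j] \<Gamma>[OF i(1)]] by blast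
  qed
  have rad: "\<exists>i\<in>{1..n} - {j}. infdist 0 s = ?rad j i"
    if j: "j \<in> {1..n}" and s: "s \<in> components (ball 0 1 - \<psi> j ` \<Omega>)" for j s
  proof -
    obtain H where H: "H \<in> boundary_components \<Omega>" "H \<noteq> \<Gamma> j" "slit \<Omega> (\<psi> j) H = s"
      using slit_boundary_component[OF S assms(6)[OF j] s] by metis
    then obtain i where "i \<in> {1..n}" "H = \<Gamma> i" using surj by blast
    then show ?thesis using H by (intro bexI[of _ i]) (auto simp: slit_radius_def)
  qed
  \<comment> \<open>For every \<open>j\<close> some slit radius is admissible in the supremum; the
    minimum over \<open>i\<close> lies below it.\<close>
  have lower: "\<exists>i\<in>{1..n} - {j}. ?rad j i \<in> ?R" if j: "j \<in> {1..n}" for j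
  proof -
    obtain s where s: "s \<in> components (ball 0 1 - \<psi> j ` \<Omega>)" "infdist 0 s \<in> ?R"
      by (rule slit_map_squeezing[OF S assms(6)[OF j] not_disc[OF j]])
    then show ?thesis using rad[OF j s(1)] by (metis (no_types, lifting))
  qed
  have upper: "\<exists>j\<in>{1..n}. \<exists>i\<in>{1..n} - {j}. r \<le> ?rad j i" if r: "r \<in> ?R" for r
  proof -
    obtain f where f: "f \<in> univalent_maps \<Omega>" "f z = 0" "0 < r" "ball 0 r \<subseteq> f ` \<Omega>" using r by blast
    obtain G where G: "G \<in> boundary_components \<Omega>"
      "\<And>\<psi>. slit_map \<Omega> z G \<psi> \<Longrightarrow> \<psi> ` \<Omega> \<noteq> ball 0 1 \<Longrightarrow> \<exists>x\<in>ball 0 1 - \<psi> ` \<Omega>. r \<le> norm x"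
      using univalent_map_slit_radius[OF S f] by metis
    then obtain j where j: "j \<in> {1..n}" "G = \<Gamma> j" using surj by blast
    then obtain x where x: "x \<in> ball 0 1 - \<psi> j ` \<Omega>" "r \<le> norm x"
      using G(2)[of "\<psi> j"] assms(6)[OF j(1)] not_disc[OF j(1)] by blast
    then obtain s where s: "s \<in> components (ball 0 1 - \<psi> j ` \<Omega>)" "x \<in> s"
      using Union_components[of "ball 0 1 - \<psi> j ` \<Omega>"] by blast
    have "infdist 0 s = norm x"
      using slit_norm slit_mapD(10)[OF assms(6)[OF j(1)] S(1,3) s(1)] s(2) by blast
    then show ?thesis using rad[OF j(1) s(1)] x(2) j(1) by metis
  qed
  have ne: "{1..n} \<noteq> {}" "\<And>j. {1..n} - {j} \<noteq> {}"
  proof -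
    show "{1..n} \<noteq> {}" using assms(1) by auto
    have "(if j = 1 then 2 else 1) \<in> {1..n} - {j}" for j using assms(1) by auto
    then show "{1..n} - {j} \<noteq> {}" for j by (metis empty_iff)
  qed
  have "(MAX j\<in>{1..n}. MIN i\<in>{1..n} - {j}. ?rad j i) \<le> squeezing \<Omega> z"
  proof (rule Max.boundedI)
    fix m assume "m \<in> (\<lambda>j. MIN i\<in>{1..n} - {j}. ?rad j i) ` {1..n}"
    then obtain j where j: "j \<in> {1..n}" "m = (MIN i\<in>{1..n} - {j}. ?rad j i)" by blast
    obtain i where i: "i \<in> {1..n} - {j}" "?rad j i \<in> ?R" using lower[OF j(1)] by blast
    have "m \<le> ?rad j i" unfolding j(2) using i(1) by (intro Min_le) auto
    also have "\<dots> \<le> squeezing \<Omega> z"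
      unfolding squeezing_def using i(2) by (intro cSup_upper bdd_above_squeezing)
    finally show "m \<le> squeezing \<Omega> z" .
  qed (use ne in auto)
  moreover have "squeezing \<Omega> z \<le> (MAX j\<in>{1..n}. MAX i\<in>{1..n} - {j}. ?rad j i)"
    unfolding squeezing_def
  proof (rule cSup_least)
    \<comment> \<open>The competitor found for the lower bound makes the real supremum
      meaningful.\<close>
    show "?R \<noteq> {}" using lower ne(1) by blast
    fix r assume "r \<in> ?R"
    then obtain j i where ij: "j \<in> {1..n}" "i \<in> {1..n} - {j}" "r \<le> ?rad j i" using upper[OF \<open>r \<in> ?R\<close>] by blast
    note ij(3)
    also have "?rad j i \<le> (MAX i\<in>{1..n} - {j}. ?rad j i)" using ij(2) by (intro Max_ge) auto
    also have "\<dots> \<le> (MAX j\<in>{1..n}. MAX i\<in>{1..n} - {j}. ?rad j i)" using ij(1) by (intro Max_ge) auto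
    finally show "r \<le> (MAX j\<in>{1..n}. MAX i\<in>{1..n} - {j}. ?rad j i)" .
  qed
  ultimately show ?thesis by blast
qed

end
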